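(* In the setting of the context (a nonholonomic system with $G$-symmetry and vertical-symmetry condition, $H=G/G_W$ abelian, and a 2-form $\bar B$ on $T^*\bar Q$ with $\mathbf i_{\bar X_{nh}}\bar B=0$ and $\overline{\langle\mathcal J,\mathcal K_W\rangle}+\bar B$ basic with respect to $\rho_H$), at each $\bar\mu\in\mathfrak h^*$ a sufficient condition for $f_{\bar\mu}\in C^\infty(\bar Q/H)$ to be such that $$f_{\bar\mu}\,(\Omega_{\bar Q/H}-\beta_{\bar\mu}-\Upsilon^*\mathfrak B_{\bar\mu})$$ is closed on $T^*(\bar Q/H)$ is that $$df_{\bar\mu}\wedge\Theta_{\bar Q/H}-f_{\bar\mu}(\beta_{\bar\mu}+\Upsilon^*\mathfrak B_{\bar\mu})=0,$$ where $\Omega_{\bar Q/H}=-d\Theta_{\bar Q/H}$.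
   Context: **Setting.** $Q$ is a smooth manifold with Lagrangian $L(v)=\frac12\kappa(v,v)-U$ ($\kappa$ a Riemannian metric, $U\in C^\infty(Q)$) and a non-integrable constant-rank distribution $D\subset TQ$. $\mathcal M=\kappa^\flat(D)\subset T^*Q$, $\tau:\mathcal M\to Q$, with $\mathcal H_{\mathcal M}$ the restricted Hamiltonian. A Lie group $G$ acts freely and properly on $Q$, its lift preserving $L$ and $D$; with $V$ tangent to the orbits, $TQ=D+V$; $W\subseteq V$ is a $G$-invariant distribution with $TQ=D\oplus W$ (projections $P_D,P_W$) and $W_q=\{\eta_Q(q):\eta\in\mathfrak g_W\}$ for a Lie subalgebra $\mathfrak g_W\subseteq\mathfrak g$ (vertical-symmetry condition; $\eta_Q$ the infinitesimal generator). $G_W$ is the connected normal subgroup integrating the ideal $\mathfrak g_W$, acting freely and properly. $\mathbf A_W(v_q)=\xi$ iff $P_W(v_q)=\xi_Q(q)$; $\mathbf K_W(X,Y)=d\mathbf A_W(P_DX,P_DY)$; $\mathcal K_W=\tau^*\mathbf K_W$; $\mathcal J:\mathcal M\to\mathfrak g^*$ is the restricted canonical momentum map. $\bar Q=Q/G_W$, $\pi:Q\to\bar Q$; $\mathcal M/G_W\simeq T^*\bar Q$ via $\rho_W$, $\langle\rho_W(\alpha_q),T\pi(u)\rangle=\langle\alpha_q,u\rangle$ ($u\in D_q$); $\rho_W^*\overline{\langle\mathcal J,\mathcal K_W\rangle}=\langle\mathcal J,\mathcal K_W\rangle$; $\rho_W^*\mathcal H_{T^*\bar Q}=\mathcal H_{\mathcal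 M}$; $\bar X_{nh}$ is given by $\mathbf i_{\bar X_{nh}}(\Omega_{\bar Q}-\overline{\langle\mathcal J,\mathcal K_W\rangle})=d\mathcal H_{T^*\bar Q}$, with $\Omega_{\bar Q}$ canonical. $H=G/G_W$ (Lie algebra $\mathfrak h$), assumed abelian, acts freely and properly on $\bar Q$ and by cotangent lift on $T^*\bar Q$ with canonical momentum map $\bar J$ and quotient $\rho_H:T^*\bar Q\to T^*\bar Q/H$. A form is basic if it is a pullback from the base. $\mathfrak B$ on $T^*\bar Q/H$ is defined by $\rho_H^*\mathfrak B=\overline{\langle\mathcal J,\mathcal K_W\rangle}+\bar B$, and $\mathfrak B_{\bar\mu}$ is its pullback to $\bar J^{-1}(\bar\mu)/H$. $\bar{\mathcal A}:T\bar Q\to\mathfrak h$ is the mechanical connection of the compressed kinetic-energy metric $\bar\kappa$ on $\bar Q$ ($\bar\kappa(T\pi u,T\pi v)=\kappa(u,v)$, $u,v\in D_q$). $\bar\tau:\bar Q\to\bar Q/H$; $\beta_{\bar\mu}$ is the 2-form on $\bar Q/H$ with $\bar\tau^*\beta_{\bar\mu}=\langle\bar\mu,d\bar{\mathcal A}\rangle$ (also denoting its pullback to $T^*(\bar Q/H)$). $\Upsilon:T^*(\bar Q/H)\to\bar J^{-1}(\bar\mu)/H$, $\alpha_x\mapsto[(T_{\bar q}\bar\tau)^*\alpha_x+\langle\bar\mu,\bar{\mathcal A}_{\bar q}\rangle]$, is a diffeomorphism. $\Theta_{\bar Q/H}$ is the canonical 1-form of $T^*(\bar Q/H)$; functions on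 $\bar Q/H$ are also regarded as functions on $T^*(\bar Q/H)$ by pullback. *)

theory Defs
  imports "HOL-Analysis.Analysis" "HOL-Library.Function_Algebras" "HOL-Algebra.Group_Action"
begin

section \<open>Pointwise real vector space structure on functions\<close>

instantiation "fun" :: (type, scaleR) scaleR
begin
definition scaleR_fun_def: "scaleR r f = (\<lambda>x. r *\<^sub>R f x)"
instance ..
end

instance "fun" :: (type, real_vector) real_vector
  by standard (auto simp: scaleR_fun_def fun_eq_iff scaleR_add_right scaleR_add_left)

definition lin_on :: "'v::real_vector set \<Rightarrow> ('v \<Rightarrow> real) \<Rightarrow> bool" where
  "lin_on V \<alpha> \<longleftrightarrow> (\<forall>u\<in>V. \<forall>v\<in>V. \<alpha> (u + v) = \<alpha> u + \<alpha> v) \<and> (\<forall>r. \<forall>v\<in>V. \<alpha> (r *\<^sub>R v) = r * \<alpha> v)"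

text \<open>The dual of a subspace \<open>V\<close> of an ambient vector space. Functionals are extended by \<open>0\<close>
  outside \<open>V\<close>, so that equality of functionals is equality on \<open>V\<close>.\<close>

definition dual :: "'v::real_vector set \<Rightarrow> ('v \<Rightarrow> real) set" where
  "dual V = {\<alpha>. lin_on V \<alpha> \<and> (\<forall>v. v \<notin> V \<longrightarrow> \<alpha> v = 0)}"


section \<open>Smooth functions on open sets of normed spaces\<close>

text \<open>\<open>C\<^sup>k\<close> on an open set \<open>S\<close>; the domain is finite-dimensional wherever this is used, so that
  smoothness of all the directional derivatives is the right condition.\<close>

primrec Ck_on :: "nat \<Rightarrow> 'e::real_normed_vector set \<Rightarrow> ('e \<Rightarrow> 'f::real_normed_vector) \<Rightarrow> bool" where
  "Ck_on 0 S f \<longleftrightarrow> continuous_on S f"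
| "Ck_on (Suc k) S f \<longleftrightarrow> (\<forall>x\<in>S. f differentiable (at x)) \<and>
     (\<forall>v. Ck_on k S (\<lambda>x. frechet_derivative f (at x) v))"

definition smooth_on :: "'e::real_normed_vector set \<Rightarrow> ('e \<Rightarrow> 'f::real_normed_vector) \<Rightarrow> bool" where
  "smooth_on S f \<longleftrightarrow> (\<forall>k. Ck_on k S f)"


section \<open>Smooth manifolds\<close>

text \<open>A chart is a domain together with a coordinate map; a manifold is given by an atlas. The model
  space is a finite-dimensional normed space. The type class \<open>euclidean_space\<close> is avoided because it
  excludes dimension \<open>0\<close>, which does occur here (for instance for the trivial group).\<close>

type_synonym ('a, 'e) chart = "'a set \<times> ('a \<Rightarrow> 'e)"
type_synonym ('a, 'e) atlas = "('a, 'e) chart set"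

abbreviation cdom :: "('a, 'e) chart \<Rightarrow> 'a set" where "cdom c \<equiv> fst c"
abbreviation cmap :: "('a, 'e) chart \<Rightarrow> 'a \<Rightarrow> 'e" where "cmap c \<equiv> snd c"
abbreviation cimg :: "('a, 'e) chart \<Rightarrow> 'e set" where "cimg c \<equiv> cmap c ` cdom c"
abbreviation cinv :: "('a, 'e) chart \<Rightarrow> 'e \<Rightarrow> 'a" where "cinv c \<equiv> inv_into (cdom c) (cmap c)"

definition pts :: "('a, 'e) atlas \<Rightarrow> 'a set" where
  "pts A = (\<Union>c\<in>A. cdom c)"

definition mtop :: "('a, 'e::real_normed_vector) atlas \<Rightarrow> 'a topology" where
  "mtop A = topology (\<lambda>U. U \<subseteq> pts A \<and> (\<forall>c\<in>A. open (cmap c ` (U \<inter> cdom c))))"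

definition manifold :: "('a, 'e::real_normed_vector) atlas \<Rightarrow> bool" where
  "manifold A \<longleftrightarrow>
     (\<exists>B. finite B \<and> span B = (UNIV :: 'e set)) \<and>
     (\<forall>c\<in>A. inj_on (cmap c) (cdom c) \<and> open (cimg c)) \<and>
     (\<forall>c\<in>A. \<forall>d\<in>A. open (cmap c ` (cdom c \<inter> cdom d)) \<and>
        smooth_on (cmap c ` (cdom c \<inter> cdom d)) (cmap d \<circ> cinv c)) \<and>
     Hausdorff_space (mtop A) \<and> second_countable (mtop A)"

definition chart_at :: "('a, 'e) atlas \<Rightarrow> 'a \<Rightarrow> ('a, 'e) chart" where
  "chart_at A p = (SOME c. c \<in> A \<and> p \<in> cdom c)"

definition smooth_map ::
  "('a, 'e::real_normed_vector) atlas \<Rightarrow> ('b, 'f::real_normed_vector) atlas \<Rightarrow> ('a \<Rightarrow> 'b) \<Rightarrow> bool" where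
  "smooth_map A B f \<longleftrightarrow> continuous_map (mtop A) (mtop B) f \<and>
     (\<forall>c\<in>A. \<forall>d\<in>B. smooth_on (cmap c ` (cdom c \<inter> f -` cdom d)) (cmap d \<circ> f \<circ> cinv c))"

definition smooth_fun :: "('a, 'e::real_normed_vector) atlas \<Rightarrow> ('a \<Rightarrow> real) \<Rightarrow> bool" where
  "smooth_fun A f \<longleftrightarrow> (\<forall>c\<in>A. smooth_on (cimg c) (f \<circ> cinv c))"

definition prod_atlas :: "('a, 'e) atlas \<Rightarrow> ('b, 'f) atlas \<Rightarrow> ('a \<times> 'b, 'e \<times> 'f) atlas" where
  "prod_atlas A B = (\<lambda>(c, d). (cdom c \<times> cdom d, map_prod (cmap c) (cmap d))) ` (A \<times> B)"

text \<open>An open subset of the model space as a manifold.\<close>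

definition open_atlas :: "'e set \<Rightarrow> ('e, 'e) atlas" where
  "open_atlas V = {(V, \<lambda>x. x)}"


section \<open>Tangent vectors and tangent maps\<close>

text \<open>A tangent vector at \<open>p\<close> is the family of its coordinate expressions in the charts around \<open>p\<close>,
  related by the derivatives of the transition maps (and \<open>0\<close> in the other charts). The base point is
  always passed separately.\<close>

type_synonym ('a, 'e) tvec = "('a, 'e) chart \<Rightarrow> 'e"

definition tspace :: "('a, 'e::real_normed_vector) atlas \<Rightarrow> 'a \<Rightarrow> ('a, 'e) tvec set" where
  "tspace A p = {v. (\<forall>c. \<not> (c \<in> A \<and> p \<in> cdom c) \<longrightarrow> v c = 0) \<and>
     (\<forall>c\<in>A. \<forall>d\<in>A. p \<in> cdom c \<and> p \<in> cdom d \<longrightarrow>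
        v d = frechet_derivative (cmap d \<circ> cinv c) (at (cmap c p)) (v c))}"

text \<open>The tangent vector at \<open>p\<close> with coordinates \<open>w\<close> in the chart \<open>c\<close>.\<close>

definition tvec_of ::
  "('a, 'e::real_normed_vector) atlas \<Rightarrow> ('a, 'e) chart \<Rightarrow> 'a \<Rightarrow> 'e \<Rightarrow> ('a, 'e) tvec" where
  "tvec_of A c p w = (\<lambda>d. if d \<in> A \<and> p \<in> cdom d
     then frechet_derivative (cmap d \<circ> cinv c) (at (cmap c p)) w else 0)"

definition tmap ::
  "('a, 'e::real_normed_vector) atlas \<Rightarrow> ('b, 'f::real_normed_vector) atlas \<Rightarrow> ('a \<Rightarrow> 'b) \<Rightarrow>
   'a \<Rightarrow> ('a, 'e) tvec \<Rightarrow> ('b, 'f) tvec" where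
  "tmap A B f p v = (let c = chart_at A p in
     (\<lambda>d. if d \<in> B \<and> f p \<in> cdom d
        then frechet_derivative (cmap d \<circ> f \<circ> cinv c) (at (cmap c p)) (v c) else 0))"

type_synonym ('a, 'e) vfield = "'a \<Rightarrow> ('a, 'e) tvec"

definition smooth_vfield_on ::
  "('a, 'e::real_normed_vector) atlas \<Rightarrow> 'a set \<Rightarrow> ('a, 'e) vfield \<Rightarrow> bool" where
  "smooth_vfield_on A U X \<longleftrightarrow> (\<forall>p\<in>U. X p \<in> tspace A p) \<and>
     (\<forall>c\<in>A. smooth_on (cmap c ` (U \<inter> cdom c)) (\<lambda>x. X (cinv c x) c))"

definition vfield_bracket ::
  "('a, 'e::real_normed_vector) atlas \<Rightarrow> ('a, 'e) vfield \<Rightarrow> ('a, 'e) vfield \<Rightarrow> ('a, 'e) vfield" where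
  "vfield_bracket A X Y p = (let c = chart_at A p; x = cmap c p in
     tvec_of A c p
      (frechet_derivative (\<lambda>y. Y (cinv c y) c) (at x) (X p c)
       - frechet_derivative (\<lambda>y. X (cinv c y) c) (at x) (Y p c)))"

definition submersion_onto ::
  "('a, 'e::real_normed_vector) atlas \<Rightarrow> ('b, 'f::real_normed_vector) atlas \<Rightarrow> ('a \<Rightarrow> 'b) \<Rightarrow> bool" where
  "submersion_onto A B f \<longleftrightarrow> smooth_map A B f \<and> f ` pts A = pts B \<and>
     (\<forall>p\<in>pts A. tmap A B f p ` tspace A p = tspace B (f p))"

definition immersed_submanifold ::
  "('a, 'e::real_normed_vector) atlas \<Rightarrow> ('a, 'f::real_normed_vector) atlas \<Rightarrow> bool" where
  "immersed_submanifold A B \<longleftrightarrow> manifold A \<and> pts A \<subseteq> pts B \<and> smooth_map A B (\<lambda>x. x) \<and>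
     (\<forall>p\<in>pts A. inj_on (tmap A B (\<lambda>x. x) p) (tspace A p))"

definition embedded_submanifold ::
  "('a, 'e::real_normed_vector) atlas \<Rightarrow> ('a, 'f::real_normed_vector) atlas \<Rightarrow> bool" where
  "embedded_submanifold A B \<longleftrightarrow> immersed_submanifold A B \<and>
     mtop A = subtopology (mtop B) (pts A)"


section \<open>Distributions\<close>

type_synonym ('a, 'e) distr = "'a \<Rightarrow> ('a, 'e) tvec set"

definition distribution :: "('a, 'e::real_normed_vector) atlas \<Rightarrow> ('a, 'e) distr \<Rightarrow> bool" where
  "distribution A D \<longleftrightarrow> (\<exists>r::nat. \<forall>p\<in>pts A. \<exists>U X. openin (mtop A) U \<and> p \<in> U \<and>
     (\<forall>i<r. smooth_vfield_on A U (X i)) \<and>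
     (\<forall>q\<in>U. inj_on (\<lambda>i. X i q) {..<r} \<and> independent ((\<lambda>i. X i q) ` {..<r}) \<and>
        D q = span ((\<lambda>i. X i q) ` {..<r})))"

text \<open>Through every point passes an integral manifold, here parametrised by a neighbourhood of \<open>0\<close> in
  a linear subspace \<open>S\<close> of the model space.\<close>

definition integrable_distr :: "('a, 'e::real_normed_vector) atlas \<Rightarrow> ('a, 'e) distr \<Rightarrow> bool" where
  "integrable_distr A D \<longleftrightarrow> (\<forall>p\<in>pts A. \<exists>(S :: 'e set) (V :: 'e set) \<sigma>. subspace S \<and> open V \<and> 0 \<in> V \<and>
     smooth_map (open_atlas V) A \<sigma> \<and> \<sigma> 0 = p \<and>
     (\<forall>s\<in>S \<inter> V. bij_betw
        (\<lambda>w. tmap (open_atlas V) A \<sigma> s (tvec_of (open_atlas V) (V, \<lambda>x. x) s w)) S (D (\<sigma> s))))"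


section \<open>Differential forms\<close>

type_synonym ('a, 'e) form1 = "'a \<Rightarrow> ('a, 'e) tvec \<Rightarrow> real"
type_synonym ('a, 'e) form2 = "'a \<Rightarrow> ('a, 'e) tvec \<Rightarrow> ('a, 'e) tvec \<Rightarrow> real"
type_synonym ('a, 'e) form3 =
  "'a \<Rightarrow> ('a, 'e) tvec \<Rightarrow> ('a, 'e) tvec \<Rightarrow> ('a, 'e) tvec \<Rightarrow> real"

text \<open>Coordinate expressions in a chart \<open>c\<close>.\<close>

definition loc1 ::
  "('a, 'e::real_normed_vector) atlas \<Rightarrow> ('a, 'e) chart \<Rightarrow> ('a, 'e) form1 \<Rightarrow> 'e \<Rightarrow> 'e \<Rightarrow> real" where
  "loc1 A c \<theta> x u = (let p = cinv c x in \<theta> p (tvec_of A c p u))"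

definition loc2 ::
  "('a, 'e::real_normed_vector) atlas \<Rightarrow> ('a, 'e) chart \<Rightarrow> ('a, 'e) form2 \<Rightarrow>
   'e \<Rightarrow> 'e \<Rightarrow> 'e \<Rightarrow> real" where
  "loc2 A c \<omega> x u v = (let p = cinv c x in \<omega> p (tvec_of A c p u) (tvec_of A c p v))"

definition tensor2 :: "('a, 'e::real_normed_vector) atlas \<Rightarrow> ('a, 'e) form2 \<Rightarrow> bool" where
  "tensor2 A b \<longleftrightarrow>
     (\<forall>p\<in>pts A. \<forall>u\<in>tspace A p. lin_on (tspace A p) (b p u) \<and> lin_on (tspace A p) (\<lambda>v. b p v u)) \<and>
     (\<forall>c\<in>A. \<forall>u v. smooth_on (cimg c) (\<lambda>x. loc2 A c b x u v))"

definition two_form :: "('a, 'e::real_normed_vector) atlas \<Rightarrow> ('a, 'e) form2 \<Rightarrow> bool" where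
  "two_form A \<omega> \<longleftrightarrow> tensor2 A \<omega> \<and>
     (\<forall>p\<in>pts A. \<forall>u\<in>tspace A p. \<forall>v\<in>tspace A p. \<omega> p u v = - \<omega> p v u)"

definition riemannian_metric :: "('a, 'e::real_normed_vector) atlas \<Rightarrow> ('a, 'e) form2 \<Rightarrow> bool" where
  "riemannian_metric A \<kappa> \<longleftrightarrow> tensor2 A \<kappa> \<and>
     (\<forall>p\<in>pts A. \<forall>u\<in>tspace A p. \<forall>v\<in>tspace A p. \<kappa> p u v = \<kappa> p v u) \<and>
     (\<forall>p\<in>pts A. \<forall>u\<in>tspace A p. u \<noteq> 0 \<longrightarrow> 0 < \<kappa> p u u)"

definition d0 :: "('a, 'e::real_normed_vector) atlas \<Rightarrow> ('a \<Rightarrow> real) \<Rightarrow> ('a, 'e) form1" where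
  "d0 A f p v = (let c = chart_at A p in
     frechet_derivative (f \<circ> cinv c) (at (cmap c p)) (v c))"

definition d1 :: "('a, 'e::real_normed_vector) atlas \<Rightarrow> ('a, 'e) form1 \<Rightarrow> ('a, 'e) form2" where
  "d1 A \<theta> p u v = (let c = chart_at A p; x = cmap c p in
       frechet_derivative (\<lambda>y. loc1 A c \<theta> y (v c)) (at x) (u c)
     - frechet_derivative (\<lambda>y. loc1 A c \<theta> y (u c)) (at x) (v c))"

definition d2 :: "('a, 'e::real_normed_vector) atlas \<Rightarrow> ('a, 'e) form2 \<Rightarrow> ('a, 'e) form3" where
  "d2 A \<omega> p u v w = (let c = chart_at A p; x = cmap c p in
       frechet_derivative (\<lambda>y. loc2 A c \<omega> y (v c) (w c)) (at x) (u c)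
     - frechet_derivative (\<lambda>y. loc2 A c \<omega> y (u c) (w c)) (at x) (v c)
     + frechet_derivative (\<lambda>y. loc2 A c \<omega> y (u c) (v c)) (at x) (w c))"

definition closed2 :: "('a, 'e::real_normed_vector) atlas \<Rightarrow> ('a, 'e) form2 \<Rightarrow> bool" where
  "closed2 A \<omega> \<longleftrightarrow> (\<forall>p\<in>pts A. \<forall>u\<in>tspace A p. \<forall>v\<in>tspace A p. \<forall>w\<in>tspace A p. d2 A \<omega> p u v w = 0)"

definition wedge11 :: "('a, 'e) form1 \<Rightarrow> ('a, 'e) form1 \<Rightarrow> ('a, 'e) form2" where
  "wedge11 \<alpha> \<beta> p u v = \<alpha> p u * \<beta> p v - \<alpha> p v * \<beta> p u"

definition form2_eq ::
  "('a, 'e::real_normed_vector) atlas \<Rightarrow> ('a, 'e) form2 \<Rightarrow> ('a, 'e) form2 \<Rightarrow> bool" where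
  "form2_eq A \<omega> \<eta> \<longleftrightarrow> (\<forall>p\<in>pts A. \<forall>u\<in>tspace A p. \<forall>v\<in>tspace A p. \<omega> p u v = \<eta> p u v)"

definition pull2 ::
  "('a, 'e::real_normed_vector) atlas \<Rightarrow> ('b, 'f::real_normed_vector) atlas \<Rightarrow> ('a \<Rightarrow> 'b) \<Rightarrow>
   ('b, 'f) form2 \<Rightarrow> ('a, 'e) form2" where
  "pull2 A B f \<omega> p u v = \<omega> (f p) (tmap A B f p u) (tmap A B f p v)"

definition basic2 ::
  "('a, 'e::real_normed_vector) atlas \<Rightarrow> ('b, 'f::real_normed_vector) atlas \<Rightarrow> ('a \<Rightarrow> 'b) \<Rightarrow>
   ('a, 'e) form2 \<Rightarrow> bool" where
  "basic2 A B f \<omega> \<longleftrightarrow> (\<exists>\<eta>. two_form B \<eta> \<and> form2_eq A (pull2 A B f \<eta>) \<omega>)"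

text \<open>Exterior derivative of a 1-form with values in a (finite-dimensional) vector space \<open>E\<close>,
  characterised by \<open>\<langle>\<mu>, d\<theta>\<rangle> = d\<langle>\<mu>, \<theta>\<rangle>\<close> for all \<open>\<mu>\<close> in the dual of \<open>E\<close>.\<close>

definition vec_d1 ::
  "('a, 'e::real_normed_vector) atlas \<Rightarrow> 'v::real_vector set \<Rightarrow> ('a \<Rightarrow> ('a, 'e) tvec \<Rightarrow> 'v) \<Rightarrow>
   'a \<Rightarrow> ('a, 'e) tvec \<Rightarrow> ('a, 'e) tvec \<Rightarrow> 'v" where
  "vec_d1 A E \<theta> p u v = (THE \<xi>. \<xi> \<in> E \<and> (\<forall>\<mu>\<in>dual E. \<mu> \<xi> = d1 A (\<lambda>q w. \<mu> (\<theta> q w)) p u v))"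


section \<open>Cotangent bundles\<close>

type_synonym ('a, 'e) covec = "('a, 'e) tvec \<Rightarrow> real"

definition cotspace :: "('a, 'e::real_normed_vector) atlas \<Rightarrow> 'a \<Rightarrow> ('a, 'e) covec set" where
  "cotspace A p = dual (tspace A p)"

definition ctb ::
  "('a, 'e::real_normed_vector) atlas \<Rightarrow> ('a \<times> ('a, 'e) covec, 'e \<times> ('e \<Rightarrow>\<^sub>L real)) atlas" where
  "ctb A = (\<lambda>c. ({(q, \<alpha>). q \<in> cdom c \<and> \<alpha> \<in> cotspace A q},
                 \<lambda>(q, \<alpha>). (cmap c q, Blinfun (\<lambda>w. \<alpha> (tvec_of A c q w))))) ` A"

definition canonical_1form ::
  "('a, 'e::real_normed_vector) atlas \<Rightarrow>
   ('a \<times> ('a, 'e) covec, 'e \<times> ('e \<Rightarrow>\<^sub>L real)) form1" where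
  "canonical_1form A m w = snd m (tmap (ctb A) A fst m w)"

definition canonical_2form ::
  "('a, 'e::real_normed_vector) atlas \<Rightarrow>
   ('a \<times> ('a, 'e) covec, 'e \<times> ('e \<Rightarrow>\<^sub>L real)) form2" where
  "canonical_2form A m u v = - d1 (ctb A) (canonical_1form A) m u v"


section \<open>Lie groups and smooth actions\<close>

definition lie_group :: "('g, 'z) monoid_scheme \<Rightarrow> ('g, 'd::real_normed_vector) atlas \<Rightarrow> bool" where
  "lie_group G AG \<longleftrightarrow> group G \<and> manifold AG \<and> pts AG = carrier G \<and>
     smooth_map (prod_atlas AG AG) AG (\<lambda>(g, h). g \<otimes>\<^bsub>G\<^esub> h) \<and>
     smooth_map AG AG (\<lambda>g. inv\<^bsub>G\<^esub> g)"

definition lie_algebra ::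
  "('g, 'z) monoid_scheme \<Rightarrow> ('g, 'd::real_normed_vector) atlas \<Rightarrow> ('g, 'd) tvec set" where
  "lie_algebra G AG = tspace AG \<one>\<^bsub>G\<^esub>"

definition left_inv_field ::
  "('g, 'z) monoid_scheme \<Rightarrow> ('g, 'd::real_normed_vector) atlas \<Rightarrow> ('g, 'd) tvec \<Rightarrow>
   ('g, 'd) vfield" where
  "left_inv_field G AG \<xi> g = tmap AG AG (\<lambda>h. g \<otimes>\<^bsub>G\<^esub> h) \<one>\<^bsub>G\<^esub> \<xi>"

definition lie_bracket ::
  "('g, 'z) monoid_scheme \<Rightarrow> ('g, 'd::real_normed_vector) atlas \<Rightarrow> ('g, 'd) tvec \<Rightarrow>
   ('g, 'd) tvec \<Rightarrow> ('g, 'd) tvec" where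
  "lie_bracket G AG \<xi> \<eta> =
     vfield_bracket AG (left_inv_field G AG \<xi>) (left_inv_field G AG \<eta>) \<one>\<^bsub>G\<^esub>"

definition lie_subalgebra ::
  "('g, 'z) monoid_scheme \<Rightarrow> ('g, 'd::real_normed_vector) atlas \<Rightarrow> ('g, 'd) tvec set \<Rightarrow> bool" where
  "lie_subalgebra G AG s \<longleftrightarrow> s \<subseteq> lie_algebra G AG \<and> subspace s \<and>
     (\<forall>\<xi>\<in>s. \<forall>\<eta>\<in>s. lie_bracket G AG \<xi> \<eta> \<in> s)"

definition lie_ideal ::
  "('g, 'z) monoid_scheme \<Rightarrow> ('g, 'd::real_normed_vector) atlas \<Rightarrow> ('g, 'd) tvec set \<Rightarrow> bool" where
  "lie_ideal G AG s \<longleftrightarrow> lie_subalgebra G AG s \<and>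
     (\<forall>\<xi>\<in>lie_algebra G AG. \<forall>\<eta>\<in>s. lie_bracket G AG \<xi> \<eta> \<in> s)"

text \<open>\<open>N\<close>, with the smooth structure \<open>AN\<close>, is the connected (immersed) Lie subgroup of \<open>G\<close> with Lie
  algebra \<open>s\<close>.\<close>

definition connected_subgroup_integrating ::
  "('g, 'z) monoid_scheme \<Rightarrow> ('g, 'd::real_normed_vector) atlas \<Rightarrow> ('g, 'd) tvec set \<Rightarrow>
   'g set \<Rightarrow> ('g, 'n::real_normed_vector) atlas \<Rightarrow> bool" where
  "connected_subgroup_integrating G AG s N AN \<longleftrightarrow>
     subgroup N G \<and> lie_group (G\<lparr>carrier := N\<rparr>) AN \<and> immersed_submanifold AN AG \<and>
     connected_space (mtop AN) \<and>
     tmap AN AG (\<lambda>x. x) \<one>\<^bsub>G\<^esub> ` tspace AN \<one>\<^bsub>G\<^esub> = s"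

definition smooth_action ::
  "('g, 'z) monoid_scheme \<Rightarrow> ('g, 'd::real_normed_vector) atlas \<Rightarrow>
   ('a, 'e::real_normed_vector) atlas \<Rightarrow> ('g \<Rightarrow> 'a \<Rightarrow> 'a) \<Rightarrow> bool" where
  "smooth_action G AG A \<Phi> \<longleftrightarrow>
     smooth_map (prod_atlas AG A) A (\<lambda>(g, q). \<Phi> g q) \<and>
     (\<forall>q\<in>pts A. \<Phi> \<one>\<^bsub>G\<^esub> q = q) \<and>
     (\<forall>g\<in>carrier G. \<forall>h\<in>carrier G. \<forall>q\<in>pts A. \<Phi> (g \<otimes>\<^bsub>G\<^esub> h) q = \<Phi> g (\<Phi> h q))"

definition free_proper_action ::
  "('g, 'z) monoid_scheme \<Rightarrow> ('g, 'd::real_normed_vector) atlas \<Rightarrow>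
   ('a, 'e::real_normed_vector) atlas \<Rightarrow> ('g \<Rightarrow> 'a \<Rightarrow> 'a) \<Rightarrow> bool" where
  "free_proper_action G AG A \<Phi> \<longleftrightarrow> smooth_action G AG A \<Phi> \<and>
     (\<forall>g\<in>carrier G. \<forall>q\<in>pts A. \<Phi> g q = q \<longrightarrow> g = \<one>\<^bsub>G\<^esub>) \<and>
     proper_map (prod_topology (mtop AG) (mtop A)) (prod_topology (mtop A) (mtop A))
       (\<lambda>(g, q). (\<Phi> g q, q))"

text \<open>The manifold structure on the orbit space; it is the unique one making the orbit projection a
  submersion.\<close>

definition orbit_manifold ::
  "('g, 'z) monoid_scheme \<Rightarrow> ('g \<Rightarrow> 'a \<Rightarrow> 'a) \<Rightarrow> ('a, 'e::real_normed_vector) atlas \<Rightarrow>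
   ('a set, 'f::real_normed_vector) atlas \<Rightarrow> bool" where
  "orbit_manifold G \<Phi> A B \<longleftrightarrow> manifold B \<and> pts B = orbits G (pts A) \<Phi> \<and>
     submersion_onto A B (orbit G \<Phi>)"

definition inf_generator ::
  "('g, 'z) monoid_scheme \<Rightarrow> ('g, 'd::real_normed_vector) atlas \<Rightarrow>
   ('a, 'e::real_normed_vector) atlas \<Rightarrow> ('g \<Rightarrow> 'a \<Rightarrow> 'a) \<Rightarrow> ('g, 'd) tvec \<Rightarrow> ('a, 'e) vfield" where
  "inf_generator G AG A \<Phi> \<xi> q = tmap AG A (\<lambda>g. \<Phi> g q) \<one>\<^bsub>G\<^esub> \<xi>"

text \<open>Cotangent lift \<open>g \<cdot> \<alpha>\<^sub>q = (T\<Phi>\<^bsub>inv g\<^esub>)\<^sup>* \<alpha>\<^sub>q\<close>.\<close>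

definition cot_lift ::
  "('g, 'z) monoid_scheme \<Rightarrow> ('a, 'e::real_normed_vector) atlas \<Rightarrow> ('g \<Rightarrow> 'a \<Rightarrow> 'a) \<Rightarrow>
   'g \<Rightarrow> 'a \<times> ('a, 'e) covec \<Rightarrow> 'a \<times> ('a, 'e) covec" where
  "cot_lift G A \<Phi> g = (\<lambda>(q, \<alpha>). (\<Phi> g q,
     \<lambda>v. if v \<in> tspace A (\<Phi> g q) then \<alpha> (tmap A A (\<Phi> (inv\<^bsub>G\<^esub> g)) (\<Phi> g q) v) else 0))"

definition momentum_map ::
  "('g, 'z) monoid_scheme \<Rightarrow> ('g, 'd::real_normed_vector) atlas \<Rightarrow>
   ('a, 'e::real_normed_vector) atlas \<Rightarrow> ('g \<Rightarrow> 'a \<Rightarrow> 'a) \<Rightarrow>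
   'a \<times> ('a, 'e) covec \<Rightarrow> ('g, 'd) covec" where
  "momentum_map G AG A \<Phi> = (\<lambda>(q, \<alpha>) \<xi>.
     if \<xi> \<in> lie_algebra G AG then \<alpha> (inf_generator G AG A \<Phi> \<xi> q) else 0)"

text \<open>Action of a quotient group, whose elements are cosets, on the orbit space of the normal
  subgroup.\<close>

definition quotient_action :: "('g \<Rightarrow> 'a \<Rightarrow> 'a) \<Rightarrow> 'g set \<Rightarrow> 'a set \<Rightarrow> 'a set" where
  "quotient_action \<Phi> a x = {\<Phi> g q | g q. g \<in> a \<and> q \<in> x}"


section \<open>Nonholonomic systems with symmetry\<close>

definition lagrangian ::
  "('q, 'e) form2 \<Rightarrow> ('q \<Rightarrow> real) \<Rightarrow> 'q \<Rightarrow> ('q, 'e) tvec \<Rightarrow> real" where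
  "lagrangian \<kappa> U q v = \<kappa> q v v / 2 - U q"

definition flat ::
  "('q, 'e::real_normed_vector) atlas \<Rightarrow> ('q, 'e) form2 \<Rightarrow> 'q \<Rightarrow> ('q, 'e) tvec \<Rightarrow> ('q, 'e) covec" where
  "flat Q \<kappa> q v = (\<lambda>w. if w \<in> tspace Q q then \<kappa> q v w else 0)"

text \<open>Legendre transform of the Lagrangian.\<close>

definition hamiltonian ::
  "('q, 'e::real_normed_vector) atlas \<Rightarrow> ('q, 'e) form2 \<Rightarrow> ('q \<Rightarrow> real) \<Rightarrow>
   'q \<times> ('q, 'e) covec \<Rightarrow> real" where
  "hamiltonian Q \<kappa> U = (\<lambda>(q, \<alpha>).
     let v = (THE v. v \<in> tspace Q q \<and> flat Q \<kappa> q v = \<alpha>) in \<alpha> v - lagrangian \<kappa> U q v)"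

definition constraint_set ::
  "('q, 'e::real_normed_vector) atlas \<Rightarrow> ('q, 'e) form2 \<Rightarrow> ('q, 'e) distr \<Rightarrow>
   ('q \<times> ('q, 'e) covec) set" where
  "constraint_set Q \<kappa> D = {(q, flat Q \<kappa> q v) | q v. q \<in> pts Q \<and> v \<in> D q}"

definition vertical ::
  "('g, 'z) monoid_scheme \<Rightarrow> ('g, 'd::real_normed_vector) atlas \<Rightarrow>
   ('a, 'e::real_normed_vector) atlas \<Rightarrow> ('g \<Rightarrow> 'a \<Rightarrow> 'a) \<Rightarrow> ('a, 'e) distr" where
  "vertical G AG A \<Phi> q = (\<lambda>\<xi>. inf_generator G AG A \<Phi> \<xi> q) ` lie_algebra G AG"

definition invariant_distr ::
  "('g, 'z) monoid_scheme \<Rightarrow> ('a, 'e::real_normed_vector) atlas \<Rightarrow> ('g \<Rightarrow> 'a \<Rightarrow> 'a) \<Rightarrow>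
   ('a, 'e) distr \<Rightarrow> bool" where
  "invariant_distr G A \<Phi> D \<longleftrightarrow>
     (\<forall>g\<in>carrier G. \<forall>q\<in>pts A. tmap A A (\<Phi> g) q ` D q = D (\<Phi> g q))"

definition invariant_lagrangian ::
  "('g, 'z) monoid_scheme \<Rightarrow> ('a, 'e::real_normed_vector) atlas \<Rightarrow> ('g \<Rightarrow> 'a \<Rightarrow> 'a) \<Rightarrow>
   ('a \<Rightarrow> ('a, 'e) tvec \<Rightarrow> real) \<Rightarrow> bool" where
  "invariant_lagrangian G A \<Phi> L \<longleftrightarrow>
     (\<forall>g\<in>carrier G. \<forall>q\<in>pts A. \<forall>v\<in>tspace A q. L (\<Phi> g q) (tmap A A (\<Phi> g) q v) = L q v)"

definition proj_along :: "('a, 'e::real_normed_vector) distr \<Rightarrow> ('a, 'e) distr \<Rightarrow>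
   'a \<Rightarrow> ('a, 'e) tvec \<Rightarrow> ('a, 'e) tvec" where
  "proj_along D W q v = (THE u. u \<in> D q \<and> v - u \<in> W q)"

text \<open>The \<open>\<gg>\<close>-valued 1-form \<open>A\<^sub>W\<close> and the 2-form \<open>K\<^sub>W\<close> on \<open>Q\<close>.\<close>

definition A_W ::
  "('g, 'z) monoid_scheme \<Rightarrow> ('g, 'd::real_normed_vector) atlas \<Rightarrow>
   ('q, 'e::real_normed_vector) atlas \<Rightarrow> ('g \<Rightarrow> 'q \<Rightarrow> 'q) \<Rightarrow> ('q, 'e) distr \<Rightarrow> ('q, 'e) distr \<Rightarrow>
   'q \<Rightarrow> ('q, 'e) tvec \<Rightarrow> ('g, 'd) tvec" where
  "A_W G AG Q \<Phi> D W q v = (THE \<xi>. \<xi> \<in> lie_algebra G AG \<and>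
     proj_along W D q v = inf_generator G AG Q \<Phi> \<xi> q)"

definition K_W ::
  "('g, 'z) monoid_scheme \<Rightarrow> ('g, 'd::real_normed_vector) atlas \<Rightarrow>
   ('q, 'e::real_normed_vector) atlas \<Rightarrow> ('g \<Rightarrow> 'q \<Rightarrow> 'q) \<Rightarrow> ('q, 'e) distr \<Rightarrow> ('q, 'e) distr \<Rightarrow>
   'q \<Rightarrow> ('q, 'e) tvec \<Rightarrow> ('q, 'e) tvec \<Rightarrow> ('g, 'd) tvec" where
  "K_W G AG Q \<Phi> D W q u v = vec_d1 Q (lie_algebra G AG) (A_W G AG Q \<Phi> D W) q
     (proj_along D W q u) (proj_along D W q v)"

text \<open>\<open>\<langle>J, \<tau>\<^sup>*K\<^sub>W\<rangle>\<close> on the constraint manifold \<open>M\<close>, with \<open>\<tau>\<close> the restriction of \<open>fst\<close>.\<close>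

definition JK_form ::
  "('g, 'z) monoid_scheme \<Rightarrow> ('g, 'd::real_normed_vector) atlas \<Rightarrow>
   ('q, 'e::real_normed_vector) atlas \<Rightarrow> ('g \<Rightarrow> 'q \<Rightarrow> 'q) \<Rightarrow> ('q, 'e) distr \<Rightarrow> ('q, 'e) distr \<Rightarrow>
   ('q \<times> ('q, 'e) covec, 'm::real_normed_vector) atlas \<Rightarrow>
   ('q \<times> ('q, 'e) covec, 'm) form2" where
  "JK_form G AG Q \<Phi> D W M m u v = momentum_map G AG Q \<Phi> m
     (K_W G AG Q \<Phi> D W (fst m) (tmap M Q fst m u) (tmap M Q fst m v))"

definition rho_W ::
  "('q, 'e::real_normed_vector) atlas \<Rightarrow> ('r, 'k::real_normed_vector) atlas \<Rightarrow> ('q \<Rightarrow> 'r) \<Rightarrow>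
   ('q, 'e) distr \<Rightarrow> 'q \<times> ('q, 'e) covec \<Rightarrow> 'r \<times> ('r, 'k) covec" where
  "rho_W Q Qb \<pi> D = (\<lambda>(q, \<alpha>). (\<pi> q,
     THE \<beta>. \<beta> \<in> cotspace Qb (\<pi> q) \<and> (\<forall>u\<in>D q. \<beta> (tmap Q Qb \<pi> q u) = \<alpha> u)))"

text \<open>Mechanical connection \<open>\<bbbI>\<^sup>-\<^sup>1 \<circ> J \<circ> \<kappa>\<^sup>\<flat>\<close> of an invariant metric, where
  \<open>\<langle>\<bbbI>\<^sub>q \<xi>, \<eta>\<rangle> = \<kappa>(\<xi>(q), \<eta>(q))\<close> is the locked inertia tensor.\<close>

definition mechanical_connection ::
  "('g, 'z) monoid_scheme \<Rightarrow> ('g, 'd::real_normed_vector) atlas \<Rightarrow>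
   ('a, 'e::real_normed_vector) atlas \<Rightarrow> ('g \<Rightarrow> 'a \<Rightarrow> 'a) \<Rightarrow> ('a, 'e) form2 \<Rightarrow>
   'a \<Rightarrow> ('a, 'e) tvec \<Rightarrow> ('g, 'd) tvec" where
  "mechanical_connection G AG A \<Phi> \<kappa> q v = (THE \<xi>. \<xi> \<in> lie_algebra G AG \<and>
     (\<forall>\<eta>\<in>lie_algebra G AG.
        \<kappa> q (inf_generator G AG A \<Phi> \<xi> q) (inf_generator G AG A \<Phi> \<eta> q)
        = momentum_map G AG A \<Phi> (q, flat A \<kappa> q v) \<eta>))"

text \<open>\<open>\<alpha>\<^sub>x \<mapsto> [(T\<tau>)\<^sup>*\<alpha>\<^sub>x + \<langle>\<mu>, \<A>\<^sub>q\<rangle>]\<close>. A point \<open>x\<close> of the orbit space is itself the fibre over \<open>x\<close>,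
  so that \<open>q\<close> is any element of \<open>x\<close>.\<close>

definition shift_map ::
  "('g, 'z) monoid_scheme \<Rightarrow> ('a, 'e::real_normed_vector) atlas \<Rightarrow>
   ('a set, 'f::real_normed_vector) atlas \<Rightarrow> ('g \<Rightarrow> 'a \<Rightarrow> 'a) \<Rightarrow>
   ('a \<Rightarrow> ('a, 'e) tvec \<Rightarrow> ('g, 'd) tvec) \<Rightarrow> ('g, 'd) covec \<Rightarrow>
   'a set \<times> ('a set, 'f) covec \<Rightarrow> ('a \<times> ('a, 'e) covec) set" where
  "shift_map G A B \<Phi> conn \<mu> = (\<lambda>(x, \<alpha>). let q = (SOME q. q \<in> x) in
     orbit G (cot_lift G A \<Phi>)
       (q, \<lambda>v. if v \<in> tspace A q then \<alpha> (tmap A B (orbit G \<Phi>) q v) + \<mu> (conn q v) else 0))"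

end

theory Submission
  imports Defs
begin

text \<open>On tangent vectors the hypothesis turns \<open>f (\<Omega> - \<beta> - \<Upsilon>\<^sup>*BB)\<close> into
  \<open>f \<Omega> - df \<and> \<Theta> = - d(f \<Theta>)\<close>, whose closedness in a cotangent chart is the symmetry of the second
  derivative of \<open>f\<close>. Since \<open>d1\<close> and \<open>d0\<close> are computed in a chart chosen at each point, the coordinate
  formula for \<open>\<Omega>\<close> is needed in every cotangent chart: the cotangent lift
  \<open>(x, a) \<mapsto> (\<phi> x, a \<circ> (D\<phi> x)\<^sup>-\<^sup>1)\<close> of a change of coordinates \<open>\<phi>\<close> is symplectic, again by the symmetry
  of second derivatives.\<close>

section \<open>Differentiation in finite-dimensional normed spaces\<close>

text \<open>The model space carries only a norm and a finite spanning set, and fibre coordinates are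
  bounded functionals on it. Boundedness of covectors, and differentiability of the
  functional-valued fibre part of a cotangent transition, are therefore extracted from a basis and
  its dual basis. The product \<open>f * \<gamma>\<close> with
  \<open>\<gamma> = \<beta> + \<Upsilon>\<^sup>*BB\<close> is replaced as a whole by the wedge term.
  There is no division by \<open>f\<close>, so \<open>f\<close> may have zeros, and every
  coefficient that has to be differentiated is expressed through \<open>f\<close> and the cotangent
  coordinates.\<close>

text \<open>Two uses of the one-variable mean value theorem: first along \<open>u\<close>, for the
  difference of \<open>g\<close> across the step \<open>t *\<^sub>R v\<close>, then along
  \<open>v\<close>, for the derivative in direction \<open>u\<close> that this produces. The bound
  on \<open>t\<close> keeps the whole parallelogram in the ball.\<close>

lemma mixed_difference_mean_value:
  fixes g :: "'e::real_normed_vector \<Rightarrow> real"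
  assumes diff: "\<And>y. y \<in> ball x r \<Longrightarrow> g differentiable (at y)"
    and diff2: "\<And>y. y \<in> ball x r \<Longrightarrow> (\<lambda>z. frechet_derivative g (at z) u) differentiable (at y)"
    and t: "0 < t" "t * (norm u + norm v) < r"
  shows "\<exists>p\<in>ball x r. g (x + t *\<^sub>R u + t *\<^sub>R v) - g (x + t *\<^sub>R u) - g (x + t *\<^sub>R v) + g x
           = t * t * frechet_derivative (\<lambda>z. frechet_derivative g (at z) u) (at p) v"
proof -
  define Dg where "Dg = (\<lambda>y. frechet_derivative g (at y))"
  define D2 where "D2 = (\<lambda>y. frechet_derivative (\<lambda>z. Dg z u) (at y))"
  have Dg: "(g has_derivative Dg y) (at y)" if "y \<in> ball x r" for y
    using diff[OF that] frechet_derivative_works unfolding Dg_def by blast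
  have D2: "((\<lambda>z. Dg z u) has_derivative D2 y) (at y)" if "y \<in> ball x r" for y
    using diff2[OF that] frechet_derivative_works unfolding Dg_def D2_def by blast
  have lin: "linear (Dg y)" "linear (D2 y)" if "y \<in> ball x r" for y
    using Dg[OF that] D2[OF that] has_derivative_linear by auto
  have mem: "x + a *\<^sub>R u + b *\<^sub>R v \<in> ball x r" if "0 \<le> a" "a \<le> t" "0 \<le> b" "b \<le> t" for a b
  proof -
    have "norm (a *\<^sub>R u + b *\<^sub>R v) \<le> a * norm u + b * norm v"
      using that norm_triangle_ineq[of "a *\<^sub>R u" "b *\<^sub>R v"] by simp
    also have "\<dots> \<le> t * (norm u + norm v)"
      using that by (simp add: distrib_left add_mono mult_right_mono)
    finally have "norm (a *\<^sub>R u + b *\<^sub>R v) < r"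
      using t by linarith
    moreover have "dist x (x + a *\<^sub>R u + b *\<^sub>R v) = norm (a *\<^sub>R u + b *\<^sub>R v)"
      by (metis add.assoc add_diff_cancel_left' dist_commute dist_norm)
    ultimately show ?thesis
      by simp
  qed
  have path: "((\<lambda>a. g (x + a *\<^sub>R u + b *\<^sub>R v)) has_real_derivative Dg (x + a *\<^sub>R u + b *\<^sub>R v) u) (at a)"
    if "0 \<le> a" "a \<le> t" "0 \<le> b" "b \<le> t" for a b
  proof -
    have "((\<lambda>a. x + a *\<^sub>R u + b *\<^sub>R v) has_derivative (\<lambda>h. h *\<^sub>R u)) (at a)"
      by (auto intro!: derivative_eq_intros)
    from has_derivative_compose[OF this Dg[OF mem[OF that]]]
    show ?thesis
      using lin(1)[OF mem[OF that]]
      by (simp add: has_field_derivative_def linear_scale mult_commute_abs)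
  qed
  have h: "\<exists>a. 0 < a \<and> a < t \<and>
      (g (x + t *\<^sub>R u + t *\<^sub>R v) - g (x + t *\<^sub>R u + 0 *\<^sub>R v)) - (g (x + 0 *\<^sub>R u + t *\<^sub>R v) - g (x + 0 *\<^sub>R u + 0 *\<^sub>R v))
      = (t - 0) * (Dg (x + a *\<^sub>R u + t *\<^sub>R v) u - Dg (x + a *\<^sub>R u + 0 *\<^sub>R v) u)"
    by (rule MVT2[of 0 t "\<lambda>a. g (x + a *\<^sub>R u + t *\<^sub>R v) - g (x + a *\<^sub>R u + 0 *\<^sub>R v)"])
      (use t in \<open>auto intro!: DERIV_diff path path[of _ 0, simplified]\<close>)
  then obtain a where a: "0 < a" "a < t" and
    eq: "g (x + t *\<^sub>R u + t *\<^sub>R v) - g (x + t *\<^sub>R u) - g (x + t *\<^sub>R v) + g x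
      = t * (Dg (x + a *\<^sub>R u + t *\<^sub>R v) u - Dg (x + a *\<^sub>R u + 0 *\<^sub>R v) u)"
    by (auto simp: algebra_simps)
  have path2: "((\<lambda>b. Dg (x + a *\<^sub>R u + b *\<^sub>R v) u) has_real_derivative D2 (x + a *\<^sub>R u + b *\<^sub>R v) v) (at b)"
    if "0 \<le> b" "b \<le> t" for b
  proof -
    have m: "x + a *\<^sub>R u + b *\<^sub>R v \<in> ball x r"
      using mem a that by simp
    have "((\<lambda>b. x + a *\<^sub>R u + b *\<^sub>R v) has_derivative (\<lambda>h. h *\<^sub>R v)) (at b)"
      by (auto intro!: derivative_eq_intros)
    from has_derivative_compose[OF this D2[OF m]]
    show ?thesis
      using lin(2)[OF m] by (simp add: has_field_derivative_def linear_scale mult_commute_abs)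
  qed
  obtain b where b: "0 < b" "b < t" and
    eq2: "Dg (x + a *\<^sub>R u + t *\<^sub>R v) u - Dg (x + a *\<^sub>R u + 0 *\<^sub>R v) u
      = (t - 0) * D2 (x + a *\<^sub>R u + b *\<^sub>R v) v"
    using MVT2[of 0 t "\<lambda>b. Dg (x + a *\<^sub>R u + b *\<^sub>R v) u", OF t(1) path2] by auto
  have "x + a *\<^sub>R u + b *\<^sub>R v \<in> ball x r"
    using mem a b by simp
  then show ?thesis
    using eq eq2 unfolding D2_def Dg_def by (metis diff_zero mult.assoc)
qed

text \<open>The second difference is unchanged when \<open>u\<close> and \<open>v\<close> are
  exchanged, so after division by \<open>t * t\<close> it is a value of both mixed derivatives, at
  points near \<open>x\<close>. Continuity at \<open>x\<close> brings the two within any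
  \<open>e\<close> of each other.\<close>

lemma Ck_on_2_symmetric:
  fixes g :: "'e::real_normed_vector \<Rightarrow> real"
  assumes S: "open S" "x \<in> S" and g: "Ck_on (Suc (Suc 0)) S g"
  shows "frechet_derivative (\<lambda>z. frechet_derivative g (at z) u) (at x) v
       = frechet_derivative (\<lambda>z. frechet_derivative g (at z) v) (at x) u"
proof -
  define D2 where "D2 = (\<lambda>u v y. frechet_derivative (\<lambda>z. frechet_derivative g (at z) u) (at y) v)"
  have cont: "isCont (D2 u v) x" for u v
    using g S by (auto simp: D2_def continuous_on_eq_continuous_at)
  have "\<bar>D2 u v x - D2 v u x\<bar> \<le> e" if "e > 0" for e
  proof -
    have "eventually (\<lambda>y. dist (D2 u v y) (D2 u v x) < e/2) (nhds x)" for u v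
      by (rule tendstoD) (use cont[of u v] \<open>e > 0\<close> in
        \<open>simp_all add: continuous_within tendsto_at_iff_tendsto_nhds\<close>)
    note this[of u v] this[of v u]
    moreover have "eventually (\<lambda>y. y \<in> S) (nhds x)"
      using S eventually_nhds by blast
    ultimately have "eventually (\<lambda>y. dist (D2 u v y) (D2 u v x) < e/2 \<and> dist (D2 v u y) (D2 v u x) < e/2 \<and> y \<in> S) (nhds x)"
      by (auto intro: eventually_conj)
    then obtain r where r: "r > 0" "\<And>y. dist y x < r \<Longrightarrow>
        dist (D2 u v y) (D2 u v x) < e/2 \<and> dist (D2 v u y) (D2 v u x) < e/2 \<and> y \<in> S"
      unfolding eventually_nhds_metric by blast
    \<comment> \<open>The \<open>+ 1\<close> keeps the denominator positive when both vectors
      vanish; the factor 2 makes the steps reach at most \<open>r / 2\<close>.\<close>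
    define t where "t = r / (2 * (norm u + norm v + 1))"
    have n: "norm u + norm v + 1 > 0"
      using norm_ge_zero[of u] norm_ge_zero[of v] by linarith
    have t: "0 < t" "t * (norm u + norm v) < r"
    proof -
      show "0 < t"
        using r n by (simp add: t_def)
      then have "t * (norm u + norm v) \<le> t * (norm u + norm v + 1)"
        by simp
      also have "\<dots> = r / 2"
        using n by (simp add: t_def field_simps)
      also have "\<dots> < r"
        using r by simp
      finally show "t * (norm u + norm v) < r" .
    qed
    have d: "g differentiable (at y)"
      "(\<lambda>z. frechet_derivative g (at z) w) differentiable (at y)" if "y \<in> ball x r" for y w
      using g r(2)[of y] that by (auto simp: dist_commute)
    obtain p where p: "p \<in> ball x r"
      "g (x + t *\<^sub>R u + t *\<^sub>R v) - g (x + t *\<^sub>R u) - g (x + t *\<^sub>R v) + g x = t * t * D2 u v p"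
      using mixed_difference_mean_value[of x r g u t v] d t unfolding D2_def by blast
    obtain q where q: "q \<in> ball x r"
      "g (x + t *\<^sub>R v + t *\<^sub>R u) - g (x + t *\<^sub>R v) - g (x + t *\<^sub>R u) + g x = t * t * D2 v u q"
      using mixed_difference_mean_value[of x r g v t u] d t unfolding D2_def
      by (metis add.commute)
    have "x + t *\<^sub>R v + t *\<^sub>R u = x + t *\<^sub>R u + t *\<^sub>R v"
      by (simp add: add.commute add.left_commute)
    then have "D2 u v p = D2 v u q"
      using p q t by (simp add: algebra_simps)
    moreover have "\<bar>D2 u v p - D2 u v x\<bar> < e/2" "\<bar>D2 v u q - D2 v u x\<bar> < e/2"
      using r(2)[of p] r(2)[of q] p(1) q(1) by (auto simp: dist_real_def dist_commute)
    ultimately show ?thesis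
      by linarith
  qed
  then have "D2 u v x = D2 v u x"
    by (metis abs_le_zero_iff dense_ge eq_iff_diff_eq_0)
  then show ?thesis
    by (simp add: D2_def)
qed

text \<open>Since \<open>S\<close> is open, agreement on \<open>S\<close> passes to the derivatives,
  which are taken in the full space; this feeds the induction.\<close>

lemma Ck_on_cong:
  assumes "open S" "\<And>x. x \<in> S \<Longrightarrow> f x = g x" "Ck_on k S f"
  shows "Ck_on k S g"
  using assms(2,3)
proof (induction k arbitrary: f g)
  case 0
  then show ?case
    by (simp cong: continuous_on_cong)
next
  case (Suc k)
  have d: "(g has_derivative frechet_derivative f (at x)) (at x)" if "x \<in> S" for x
  proof (rule has_derivative_transform_within_open[OF _ assms(1) that Suc.prems(1)])
    show "(f has_derivative frechet_derivative f (at x)) (at x)"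
      using Suc.prems(2) that unfolding frechet_derivative_works[symmetric] by simp
  qed
  then have "frechet_derivative f (at x) = frechet_derivative g (at x)" if "x \<in> S" for x
    using frechet_derivative_at that by blast
  then have "Ck_on k S (\<lambda>x. frechet_derivative g (at x) v)" for v
    using Suc.IH[of "\<lambda>x. frechet_derivative f (at x) v" "\<lambda>x. frechet_derivative g (at x) v"] Suc.prems(2)
    by simp
  with d show ?case
    by (auto simp: differentiable_def)
qed

lemma frechet_derivative_blinfun_compose:
  assumes "g differentiable (at x)"
  shows "frechet_derivative (\<lambda>x. blinfun_apply a (g x)) (at x) v = blinfun_apply a (frechet_derivative g (at x) v)"
proof -
  have "((\<lambda>x. blinfun_apply a (g x)) has_derivative (\<lambda>v. blinfun_apply a (frechet_derivative g (at x) v))) (at x)"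
    using assms frechet_derivative_works
    by (intro bounded_linear.has_derivative[OF blinfun.bounded_linear_right]) blast
  from fun_cong[OF frechet_derivative_at[OF this], of v] show ?thesis
    by (rule sym)
qed

lemma Ck_on_blinfun_compose:
  assumes "open S" "Ck_on k S g"
  shows "Ck_on k S (\<lambda>x. blinfun_apply a (g x))"
  using assms(2)
proof (induction k arbitrary: g)
  case 0
  then show ?case
    by (auto intro!: continuous_intros)
next
  case (Suc k)
  have diff: "g differentiable (at x)" if "x \<in> S" for x
    using Suc.prems that by simp
  have "Ck_on k S (\<lambda>x. frechet_derivative (\<lambda>x. blinfun_apply a (g x)) (at x) v)" for v
  proof (rule Ck_on_cong[OF assms(1)])
    show "Ck_on k S (\<lambda>x. blinfun_apply a (frechet_derivative g (at x) v))"
      using Suc by simp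
  qed (simp add: frechet_derivative_blinfun_compose diff)
  moreover have "(\<lambda>x. blinfun_apply a (g x)) differentiable (at x)" if "x \<in> S" for x
    using bounded_linear.has_derivative[OF blinfun.bounded_linear_right] diff[OF that]
    unfolding differentiable_def by blast
  ultimately show ?case
    by simp
qed

text \<open>The mean value argument concerns real functions. A bounded functional \<open>a\<close>
  commutes with differentiation, so testing with it reduces to that case. The conclusion stays under
  \<open>a\<close> because second derivatives of transition maps are met below only when paired with
  a covector.\<close>

lemma Ck_on_2_symmetric_blinfun:
  fixes a :: "'f::real_normed_vector \<Rightarrow>\<^sub>L real"
  assumes S: "open S" "x \<in> S" and g: "Ck_on (Suc (Suc 0)) S g"
  shows "blinfun_apply a (frechet_derivative (\<lambda>z. frechet_derivative g (at z) u) (at x) v)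
       = blinfun_apply a (frechet_derivative (\<lambda>z. frechet_derivative g (at z) v) (at x) u)"
proof -
  have eq: "blinfun_apply a (frechet_derivative (\<lambda>z. frechet_derivative g (at z) u) (at x) v)
      = frechet_derivative (\<lambda>z. frechet_derivative (\<lambda>y. blinfun_apply a (g y)) (at z) u) (at x) v" for u v
  proof -
    have "((\<lambda>z. blinfun_apply a (frechet_derivative g (at z) u)) has_derivative
        (\<lambda>v. blinfun_apply a (frechet_derivative (\<lambda>z. frechet_derivative g (at z) u) (at x) v))) (at x)"
      using g S unfolding Ck_on.simps frechet_derivative_works[symmetric]
      by (intro bounded_linear.has_derivative[OF blinfun.bounded_linear_right])
        (simp add: frechet_derivative_works[symmetric])
    \<comment> \<open>The inner derivatives agree on all of \<open>S\<close>, not merely at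
      \<open>x\<close>, so the outer derivatives can be compared.\<close>
    then have "((\<lambda>z. frechet_derivative (\<lambda>y. blinfun_apply a (g y)) (at z) u) has_derivative
        (\<lambda>v. blinfun_apply a (frechet_derivative (\<lambda>z. frechet_derivative g (at z) u) (at x) v))) (at x)"
      by (rule has_derivative_transform_within_open[OF _ S])
        (use g in \<open>simp add: frechet_derivative_blinfun_compose\<close>)
    from fun_cong[OF frechet_derivative_at[OF this], of v] show ?thesis .
  qed
  show ?thesis
    unfolding eq by (rule Ck_on_2_symmetric[OF S Ck_on_blinfun_compose[OF S(1) g]])
qed

section \<open>Finite-dimensional spaces: bounded linear maps and coordinate functionals\<close>

text \<open>Coefficients in a basis are bounded by the norm: on the compact set of coefficient
  families in the unit cube with some basis coefficient of modulus 1, the combination is nonzero by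
  independence, hence bounded below, and scaling extends the bound. A linear map is then controlled
  by its values on the basis.\<close>

lemma linear_imp_bounded_linear_finite_span:
  fixes g :: "'e::real_normed_vector \<Rightarrow> 'f::real_normed_vector" and B :: "'e set"
  assumes B: "finite B" "span B = UNIV" and g: "linear g"
  shows "bounded_linear g"
proof -
  obtain C where C: "C \<subseteq> B" "independent C" "span C = UNIV"
    using maximal_independent_subset[of B] B(2)
    by (metis span_mono span_span subset_antisym top.extremum_uniqueI)
  have fin: "finite C"
    using C(1) B(1) finite_subset by blast
  define s where "s = (\<lambda>c :: 'e \<Rightarrow> real. \<Sum>b\<in>C. c b *\<^sub>R b)"
  \<comment> \<open>Coefficient families are functions on the whole space, so every coordinate, also
    outside \<open>C\<close>, is confined to [-1, 1]; this makes the cube compact in the product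
    topology. The second factor selects the faces in the directions of \<open>C\<close>.\<close>
  define K where "K = (Pi\<^sub>E UNIV (\<lambda>b::'e. {-1..1::real})) \<inter> (\<Union>b\<in>C. {c. \<bar>c b\<bar> = 1})"
  have "\<exists>m>0. \<forall>c\<in>K. m \<le> norm (s c)"
  proof (cases "K = {}")
    case False
    have "compact K"
      unfolding K_def
    proof (rule compact_Int_closed)
      show "compact (Pi\<^sub>E UNIV (\<lambda>b::'e. {-1..1::real}))"
        using compactin_PiE[of "\<lambda>_. euclidean" UNIV "\<lambda>b::'e. {-1..1::real}"]
        unfolding euclidean_product_topology compactin_euclidean_iff by simp
      show "closed (\<Union>b\<in>C. {c::'e \<Rightarrow> real. \<bar>c b\<bar> = 1})"
        using fin by (intro closed_UN) (auto intro!: closed_Collect_eq continuous_intros)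
    qed
    moreover have "continuous_on K (\<lambda>c. norm (s c))"
      unfolding s_def
      by (intro continuous_intros continuous_on_subset[OF continuous_on_product_coordinates] subset_UNIV)
    ultimately obtain c where c: "c \<in> K" "\<And>d. d \<in> K \<Longrightarrow> norm (s c) \<le> norm (s d)"
      using continuous_attains_inf[of K "\<lambda>c. norm (s c)"] False by blast
    have "s c \<noteq> 0"
      using c(1) independentD[OF C(2) fin order_refl, of c] unfolding s_def K_def by force
    then show ?thesis
      using c by (intro exI[of _ "norm (s c)"]) auto
  \<comment> \<open>\<open>K\<close> is empty when the basis is, that is in dimension 0; the
    constant is then arbitrary.\<close>
  qed (auto intro: exI[of _ 1])
  then obtain m where m: "m > 0" "\<And>c. c \<in> K \<Longrightarrow> m \<le> norm (s c)"
    by blast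
  have coord: "m * \<bar>c b\<bar> \<le> norm (s c)" if "b \<in> C" for c b
  proof -
    define M where "M = Max ((\<lambda>b. \<bar>c b\<bar>) ` C)"
    have M: "\<bar>c b'\<bar> \<le> M" if "b' \<in> C" for b'
      using that fin by (simp add: M_def)
    obtain b0 where b0: "b0 \<in> C" "M = \<bar>c b0\<bar>"
      using Max_in[of "(\<lambda>b. \<bar>c b\<bar>) ` C"] fin \<open>b \<in> C\<close> unfolding M_def by blast
    show ?thesis
    proof (cases "M = 0")
      case True
      then show ?thesis
        using M[OF that] by simp
    next
      case False
      then have "M > 0"
        using b0 by simp
      \<comment> \<open>Dividing by the largest coefficient lands on a face of the cube; the value 0
        off \<open>C\<close> keeps the other coordinates inside it.\<close>
      define d where "d = (\<lambda>b. if b \<in> C then c b / M else 0)"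
      have "d \<in> K"
      proof -
        have "\<bar>d b\<bar> \<le> 1" for b
          using M[of b] \<open>M > 0\<close> by (simp add: d_def)
        then have "-1 \<le> d b \<and> d b \<le> 1" for b
          by (metis abs_le_iff minus_le_iff)
        moreover have "\<bar>d b0\<bar> = 1"
          using b0 \<open>M > 0\<close> by (simp add: d_def)
        ultimately show ?thesis
          using b0(1) by (auto simp: K_def)
      qed
      moreover have "s d = (1 / M) *\<^sub>R s c"
        unfolding s_def d_def by (simp add: scaleR_sum_right cong: sum.cong)
      ultimately have "m \<le> norm (s c) / M"
        using m(2)[of d] \<open>M > 0\<close> by simp
      then have "m * M \<le> norm (s c)"
        using \<open>M > 0\<close> by (simp add: field_simps)
      then show ?thesis
        using M[OF that] m(1) by (meson mult_left_mono order_trans less_imp_le)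
    qed
  qed
  \<comment> \<open>By \<open>coord\<close>, each coefficient of \<open>x\<close> has modulus at
    most \<open>norm x / m\<close>.\<close>
  define L where "L = (\<Sum>b\<in>C. norm (g b)) / m"
  have "norm (g x) \<le> norm x * L" for x
  proof -
    have "x \<in> span C"
      using C by simp
    then obtain c where c: "x = s c"
      unfolding span_finite[OF fin] s_def by auto
    have "norm (g x) \<le> (\<Sum>b\<in>C. \<bar>c b\<bar> * norm (g b))"
      unfolding c s_def using norm_sum[of "\<lambda>b. c b *\<^sub>R g b" C]
      by (simp add: linear_sum[OF g] linear_scale[OF g])
    also have "\<dots> \<le> (\<Sum>b\<in>C. (norm x / m) * norm (g b))"
    proof (rule sum_mono)
      fix b assume "b \<in> C"
      have "\<bar>c b\<bar> \<le> norm x / m"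
        using coord[OF \<open>b \<in> C\<close>, of c] m(1) by (simp add: c field_simps)
      then show "\<bar>c b\<bar> * norm (g b) \<le> (norm x / m) * norm (g b)"
        by (intro mult_right_mono) auto
    qed
    also have "\<dots> = norm x * L"
      by (simp add: L_def sum_distrib_left sum_divide_distrib)
    finally show ?thesis .
  qed
  then show ?thesis
    using g by (auto simp: bounded_linear_def bounded_linear_axioms_def)
qed

text \<open>Supplies the dual basis as bounded functionals, so that a functional-valued map can be
  written as a finite sum of real functions times fixed \<open>e b\<close>.\<close>

lemma finite_span_coordinates:
  fixes B :: "'e::real_normed_vector set"
  assumes B: "finite B" "span B = UNIV"
  obtains C :: "'e set" and e :: "'e \<Rightarrow> 'e \<Rightarrow>\<^sub>L real"
    where "finite C" "\<And>x. x = (\<Sum>b\<in>C. blinfun_apply (e b) x *\<^sub>R b)"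
proof -
  obtain C where C: "C \<subseteq> B" "independent C" "span C = UNIV"
    using maximal_independent_subset[of B] B(2)
    by (metis span_mono span_span subset_antisym top.extremum_uniqueI)
  have fin: "finite C"
    using C(1) B(1) finite_subset by blast
  have "linear (\<lambda>x. representation C x b)" for b
    using C by (intro linearI) (auto simp: representation_add representation_scale)
  then have "bounded_linear (\<lambda>x. representation C x b)" for b
    using linear_imp_bounded_linear_finite_span[OF B] by blast
  then have "x = (\<Sum>b\<in>C. blinfun_apply (Blinfun (\<lambda>x. representation C x b)) x *\<^sub>R b)" for x
    using sum_representation_eq[OF C(2) _ fin order_refl, of x] C(3)
    by (simp add: bounded_linear_Blinfun_apply)
  with fin show ?thesis
    by (rule that)
qed

section \<open>Atlases with differentiable transition maps\<close>

text \<open>Isolates what the chart calculus uses, so that the same lemmas serve both a manifold and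
  the atlas \<open>ctb A\<close>, whose transitions are only shown to be differentiable.\<close>

definition diff_atlas :: "('a, 'e::real_normed_vector) atlas \<Rightarrow> bool" where
  "diff_atlas A \<longleftrightarrow> (\<forall>c\<in>A. inj_on (cmap c) (cdom c)) \<and>
     (\<forall>c\<in>A. \<forall>d\<in>A. open (cmap c ` (cdom c \<inter> cdom d)) \<and>
        (\<forall>q\<in>cdom c \<inter> cdom d. (cmap d \<circ> cinv c) differentiable (at (cmap c q))))"

lemma manifold_imp_diff_atlas:
  assumes "manifold A"
  shows "diff_atlas A"
proof -
  have "(cmap d \<circ> cinv c) differentiable (at (cmap c q))"
    if "c \<in> A" "d \<in> A" "q \<in> cdom c \<inter> cdom d" for c d q
  proof -
    have "Ck_on (Suc 0) (cmap c ` (cdom c \<inter> cdom d)) (cmap d \<circ> cinv c)"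
      using assms that unfolding manifold_def smooth_on_def by blast
    then show ?thesis
      using that(3) by (simp add: image_iff)
  qed
  then show ?thesis
    using assms unfolding manifold_def diff_atlas_def by blast
qed

lemma cinv_cmap:
  "diff_atlas A \<Longrightarrow> c \<in> A \<Longrightarrow> q \<in> cdom c \<Longrightarrow> cinv c (cmap c q) = q"
  by (simp add: diff_atlas_def)

lemma open_overlap:
  "diff_atlas A \<Longrightarrow> c \<in> A \<Longrightarrow> d \<in> A \<Longrightarrow> open (cmap c ` (cdom c \<inter> cdom d))"
  by (simp add: diff_atlas_def)

lemma open_cimg:
  "diff_atlas A \<Longrightarrow> c \<in> A \<Longrightarrow> open (cimg c)"
  using open_overlap[of A c c] by simp

lemma transition_has_derivative:
  assumes "diff_atlas A" "c \<in> A" "d \<in> A" "q \<in> cdom c" "q \<in> cdom d"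
  shows "((cmap d \<circ> cinv c) has_derivative frechet_derivative (cmap d \<circ> cinv c) (at (cmap c q)))
           (at (cmap c q))"
  using assms frechet_derivative_works unfolding diff_atlas_def by blast

text \<open>Near \<open>cmap c q\<close> the function \<open>F \<circ> cinv c\<close> factors
  through the transition map, so this is the chain rule on the open image of the overlap.\<close>

lemma has_derivative_change_chart:
  assumes A: "diff_atlas A" "c \<in> A" "d \<in> A" "q \<in> cdom c" "q \<in> cdom d"
    and F: "((F \<circ> cinv d) has_derivative F') (at (cmap d q))"
  shows "((F \<circ> cinv c) has_derivative
           (\<lambda>w. F' (frechet_derivative (cmap d \<circ> cinv c) (at (cmap c q)) w))) (at (cmap c q))"
proof (rule has_derivative_transform_within_open)
  have "(cmap d \<circ> cinv c) (cmap c q) = cmap d q"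
    using A by (simp add: cinv_cmap)
  then show "((\<lambda>y. (F \<circ> cinv d) ((cmap d \<circ> cinv c) y)) has_derivative
           (\<lambda>w. F' (frechet_derivative (cmap d \<circ> cinv c) (at (cmap c q)) w))) (at (cmap c q))"
    using has_derivative_compose[OF transition_has_derivative[OF A]] F by fastforce
  show "open (cmap c ` (cdom c \<inter> cdom d))"
    using A open_overlap by blast
  show "cmap c q \<in> cmap c ` (cdom c \<inter> cdom d)"
    using A by blast
  show "(F \<circ> cinv d) ((cmap d \<circ> cinv c) y) = (F \<circ> cinv c) y"
    if "y \<in> cmap c ` (cdom c \<inter> cdom d)" for y
    using that A by (auto simp: cinv_cmap)
qed

text \<open>The cocycle rule: the change-of-chart lemma with the coordinate map of \<open>e\<close>
  as \<open>F\<close>.\<close>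

lemma transition_derivative_comp:
  assumes "diff_atlas A" "c \<in> A" "d \<in> A" "e \<in> A" "q \<in> cdom c" "q \<in> cdom d" "q \<in> cdom e"
  shows "frechet_derivative (cmap e \<circ> cinv d) (at (cmap d q))
           (frechet_derivative (cmap d \<circ> cinv c) (at (cmap c q)) w)
         = frechet_derivative (cmap e \<circ> cinv c) (at (cmap c q)) w"
  by (rule fun_cong[OF frechet_derivative_at[OF has_derivative_change_chart[OF assms(1-3,5,6)
        transition_has_derivative[OF assms(1,3,4,6,7)]]]])

lemma transition_derivative_self:
  assumes "diff_atlas A" "c \<in> A" "q \<in> cdom c"
  shows "frechet_derivative (cmap c \<circ> cinv c) (at (cmap c q)) w = w"
proof -
  have "((cmap c \<circ> cinv c) has_derivative (\<lambda>w. w)) (at (cmap c q))"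
    by (rule has_derivative_transform_within_open[OF has_derivative_ident open_cimg[OF assms(1,2)]])
      (use assms in \<open>auto simp: cinv_cmap\<close>)
  from fun_cong[OF frechet_derivative_at[OF this], of w] show ?thesis
    by (rule sym)
qed

lemma tvec_of_apply_self:
  assumes "diff_atlas A" "c \<in> A" "q \<in> cdom c"
  shows "tvec_of A c q w c = w"
  using assms by (simp add: tvec_of_def transition_derivative_self)

lemma tvec_of_in_tspace:
  assumes "diff_atlas A" "c \<in> A" "q \<in> cdom c"
  shows "tvec_of A c q w \<in> tspace A q"
proof -
  have "tvec_of A c q w d = frechet_derivative (cmap d \<circ> cinv e) (at (cmap e q)) (tvec_of A c q w e)"
    if "e \<in> A" "d \<in> A" "q \<in> cdom e" "q \<in> cdom d" for d e
    using transition_derivative_comp[OF assms(1,2) that(1,2) assms(3) that(3,4)] that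
    by (simp add: tvec_of_def)
  moreover have "tvec_of A c q w d = 0" if "\<not> (d \<in> A \<and> q \<in> cdom d)" for d
    using that unfolding tvec_of_def by presburger
  ultimately show ?thesis
    unfolding tspace_def by blast
qed

text \<open>In charts around \<open>q\<close> this is the compatibility condition on tangent
  vectors; in all others both sides are 0 by convention, so they are equal as functions.\<close>

lemma tvec_of_tspace:
  assumes "diff_atlas A" "c \<in> A" "q \<in> cdom c" "v \<in> tspace A q"
  shows "tvec_of A c q (v c) = v"
proof
  fix d
  show "tvec_of A c q (v c) d = v d"
  proof (cases "d \<in> A \<and> q \<in> cdom d")
    case True
    then have "v d = frechet_derivative (cmap d \<circ> cinv c) (at (cmap c q)) (v c)"
      using assms(2-4) unfolding tspace_def by blast
    with True show ?thesis
      unfolding tvec_of_def by presburger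
  next
    case False
    then have "v d = 0"
      using assms(4) unfolding tspace_def by blast
    with False show ?thesis
      unfolding tvec_of_def by presburger
  qed
qed

lemma linear_transition_derivative:
  assumes "diff_atlas A" "c \<in> A" "d \<in> A" "q \<in> cdom c" "q \<in> cdom d"
  shows "linear (frechet_derivative (cmap d \<circ> cinv c) (at (cmap c q)))"
  using transition_has_derivative[OF assms] has_derivative_linear by blast

lemma linear_tvec_of:
  assumes "diff_atlas A" "c \<in> A" "q \<in> cdom c"
  shows "linear (tvec_of A c q)"
proof (rule linearI)
  note lin = linear_transition_derivative[OF assms(1,2) _ assms(3)]
  show "tvec_of A c q (u + v) = tvec_of A c q u + tvec_of A c q v" for u v
    using linear_add[OF lin] by (auto simp: tvec_of_def fun_eq_iff)
  show "tvec_of A c q (r *\<^sub>R v) = r *\<^sub>R tvec_of A c q v" for r v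
    using linear_scale[OF lin] by (auto simp: tvec_of_def fun_eq_iff scaleR_fun_def)
qed

lemma tspace_eq_range:
  assumes "diff_atlas A" "c \<in> A" "q \<in> cdom c"
  shows "tspace A q = range (tvec_of A c q)"
proof
  show "tspace A q \<subseteq> range (tvec_of A c q)"
    using tvec_of_tspace[OF assms] by (metis rangeI subsetI)
qed (use tvec_of_in_tspace[OF assms] in blast)

lemma subspace_tspace:
  assumes "diff_atlas A" "c \<in> A" "q \<in> cdom c"
  shows "subspace (tspace A q)"
  unfolding tspace_eq_range[OF assms]
  by (rule linear_subspace_image[OF linear_tvec_of[OF assms] subspace_UNIV])

lemma chart_at_in:
  assumes "p \<in> pts A"
  shows "chart_at A p \<in> A" "p \<in> cdom (chart_at A p)"
proof -
  have "\<exists>c. c \<in> A \<and> p \<in> cdom c"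
    using assms unfolding pts_def by blast
  from someI_ex[OF this] show "chart_at A p \<in> A" "p \<in> cdom (chart_at A p)"
    unfolding chart_at_def by blast+
qed

section \<open>Charts of the cotangent bundle\<close>

definition ctb_chart ::
  "('a, 'e::real_normed_vector) atlas \<Rightarrow> ('a, 'e) chart \<Rightarrow>
   ('a \<times> ('a, 'e) covec, 'e \<times> ('e \<Rightarrow>\<^sub>L real)) chart" where
  "ctb_chart A c = ({(q, \<alpha>). q \<in> cdom c \<and> \<alpha> \<in> cotspace A q},
     \<lambda>(q, \<alpha>). (cmap c q, Blinfun (\<lambda>w. \<alpha> (tvec_of A c q w))))"

text \<open>Inverts the fibre coordinate of \<open>ctb_chart\<close>. The value 0 off
  \<open>tspace A q\<close> follows the convention of \<open>dual\<close>, under which functionals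
  equal on the tangent space are equal.\<close>

definition covec_of ::
  "('a, 'e::real_normed_vector) atlas \<Rightarrow> ('a, 'e) chart \<Rightarrow> 'a \<Rightarrow> ('e \<Rightarrow>\<^sub>L real) \<Rightarrow> ('a, 'e) covec" where
  "covec_of A c q a = (\<lambda>v. if v \<in> tspace A q then blinfun_apply a (v c) else 0)"

lemma ctb_eq: "ctb A = ctb_chart A ` A"
  by (simp add: ctb_def ctb_chart_def)

lemma mem_cdom_ctb_chart: "m \<in> cdom (ctb_chart A c) \<longleftrightarrow> fst m \<in> cdom c \<and> snd m \<in> cotspace A (fst m)"
  by (auto simp: ctb_chart_def)

lemma fst_cmap_ctb_chart: "fst (cmap (ctb_chart A c) m) = cmap c (fst m)"
  by (auto simp: ctb_chart_def split: prod.splits)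

lemma cmap_ctb_chart:
  "cmap (ctb_chart A c) (q, \<alpha>) = (cmap c q, Blinfun (\<lambda>w. \<alpha> (tvec_of A c q w)))"
  by (simp add: ctb_chart_def)

text \<open>\<open>Blinfun\<close> is meaningful only on bounded linear maps, whereas membership in
  \<open>cotspace\<close> is purely algebraic; the finite spanning set closes this gap.\<close>

lemma bounded_linear_cotspace:
  assumes A: "manifold A" "c \<in> A" "q \<in> cdom c" "\<alpha> \<in> cotspace A q"
  shows "bounded_linear (\<lambda>w. \<alpha> (tvec_of A c q w))"
proof -
  note dA = manifold_imp_diff_atlas[OF A(1)]
  obtain B :: "'b set" where B: "finite B" "span B = UNIV"
    using A(1) unfolding manifold_def by blast
  have "linear (\<lambda>w. \<alpha> (tvec_of A c q w))"
    using A(4) linear_tvec_of[OF dA A(2,3)] tvec_of_in_tspace[OF dA A(2,3)]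
    by (intro linearI) (auto simp: cotspace_def dual_def lin_on_def linear_add linear_scale)
  then show ?thesis
    by (rule linear_imp_bounded_linear_finite_span[OF B])
qed

lemma snd_cmap_ctb_chart:
  assumes "manifold A" "c \<in> A" "m \<in> cdom (ctb_chart A c)"
  shows "blinfun_apply (snd (cmap (ctb_chart A c) m)) w = snd m (tvec_of A c (fst m) w)"
  using assms bounded_linear_cotspace[of A c "fst m" "snd m"]
  by (auto simp: ctb_chart_def bounded_linear_Blinfun_apply split: prod.splits)

lemma covec_of_in_cotspace:
  assumes "diff_atlas A" "d \<in> A" "q \<in> cdom d"
  shows "covec_of A c q a \<in> cotspace A q"
proof -
  have "(r *\<^sub>R v) c = r *\<^sub>R v c" for r and v :: "('a, 'b) tvec"
    by (simp add: scaleR_fun_def)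
  then show ?thesis
    using subspace_add[OF subspace_tspace[OF assms]] subspace_scale[OF subspace_tspace[OF assms]]
    by (auto simp: cotspace_def dual_def lin_on_def covec_of_def blinfun.add_right blinfun.scaleR_right)
qed

lemma cmap_ctb_chart_covec_of:
  assumes A: "diff_atlas A" "c \<in> A" "q \<in> cdom c"
  shows "cmap (ctb_chart A c) (q, covec_of A c q a) = (cmap c q, a)"
  by (simp add: ctb_chart_def covec_of_def tvec_of_in_tspace[OF A] tvec_of_apply_self[OF A]
      blinfun_apply_inverse)

lemma covec_of_snd_cmap_ctb_chart:
  assumes A: "manifold A" "c \<in> A" "m \<in> cdom (ctb_chart A c)"
  shows "covec_of A c (fst m) (snd (cmap (ctb_chart A c) m)) = snd m"
proof
  fix v
  show "covec_of A c (fst m) (snd (cmap (ctb_chart A c) m)) v = snd m v"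
    using A tvec_of_tspace[OF manifold_imp_diff_atlas[OF A(1)] A(2), of "fst m" v]
    by (auto simp: covec_of_def snd_cmap_ctb_chart mem_cdom_ctb_chart cotspace_def dual_def)
qed

lemma inj_on_ctb_chart:
  assumes A: "manifold A" "c \<in> A"
  shows "inj_on (cmap (ctb_chart A c)) (cdom (ctb_chart A c))"
proof (rule inj_onI)
  fix m n
  assume m: "m \<in> cdom (ctb_chart A c)" and n: "n \<in> cdom (ctb_chart A c)"
    and eq: "cmap (ctb_chart A c) m = cmap (ctb_chart A c) n"
  have "cmap c (fst m) = cmap c (fst n)"
    using eq fst_cmap_ctb_chart by metis
  then have "fst m = fst n"
    using m n cinv_cmap[OF manifold_imp_diff_atlas[OF A(1)] A(2)] 
    by (metis mem_cdom_ctb_chart)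
  moreover have "snd m = snd n"
    using covec_of_snd_cmap_ctb_chart[OF A m] covec_of_snd_cmap_ctb_chart[OF A n] eq \<open>fst m = fst n\<close>
    by simp
  ultimately show "m = n"
    by (simp add: prod_eq_iff)
qed

lemma cinv_ctb_chart:
  assumes A: "manifold A" "c \<in> A" "q \<in> cdom c"
  shows "cinv (ctb_chart A c) (cmap c q, a) = (q, covec_of A c q a)"
  using inv_into_f_f[OF inj_on_ctb_chart[OF A(1,2)], of "(q, covec_of A c q a)"]
  by (simp add: cmap_ctb_chart_covec_of manifold_imp_diff_atlas A mem_cdom_ctb_chart covec_of_in_cotspace[OF _ A(2,3)])

text \<open>Cotangent charts contain whole fibres, so an overlap restricts only the base
  point.\<close>

lemma ctb_chart_overlap:
  assumes A: "manifold A" "c \<in> A"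
  shows "cmap (ctb_chart A c) ` (cdom (ctb_chart A c) \<inter> cdom (ctb_chart A d))
       = cmap c ` (cdom c \<inter> cdom d) \<times> UNIV" (is "?l = ?r")
proof
  show "?l \<subseteq> ?r"
    by (auto simp: mem_cdom_ctb_chart cmap_ctb_chart)
  show "?r \<subseteq> ?l"
  proof clarify
    fix q and a :: "'b \<Rightarrow>\<^sub>L real" assume q: "q \<in> cdom c" "q \<in> cdom d"
    have "(cmap c q, a) = cmap (ctb_chart A c) (q, covec_of A c q a)"
      using cmap_ctb_chart_covec_of manifold_imp_diff_atlas A q by metis
    moreover have "(q, covec_of A c q a) \<in> cdom (ctb_chart A c) \<inter> cdom (ctb_chart A d)"
      using q covec_of_in_cotspace[OF manifold_imp_diff_atlas[OF A(1)] A(2) q(1)]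
      by (simp add: mem_cdom_ctb_chart)
    ultimately show "(cmap c q, a) \<in> ?l"
      by blast
  qed
qed

lemma cimg_ctb_chart:
  assumes "manifold A" "c \<in> A"
  shows "cimg (ctb_chart A c) = cimg c \<times> UNIV"
  using ctb_chart_overlap[OF assms, of c] by simp

text \<open>Covectors are precomposed with the derivative of the reverse transition, because that
  derivative converts coordinates of a tangent vector in \<open>d\<close> into those in
  \<open>c\<close>.\<close>

lemma ctb_transition:
  assumes A: "manifold A" "c \<in> A" "d \<in> A" "q \<in> cdom c" "q \<in> cdom d"
  shows "(cmap (ctb_chart A d) \<circ> cinv (ctb_chart A c)) (cmap c q, a)
    = (cmap d q,
       Blinfun (\<lambda>w. blinfun_apply a (frechet_derivative (cmap c \<circ> cinv d) (at (cmap d q)) w)))"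
proof -
  have "covec_of A c q a (tvec_of A d q w)
      = blinfun_apply a (frechet_derivative (cmap c \<circ> cinv d) (at (cmap d q)) w)" for w
    using A(2,4) tvec_of_in_tspace[OF manifold_imp_diff_atlas[OF A(1)] A(3,5)]
    by (simp add: covec_of_def tvec_of_def)
  then show ?thesis
    by (simp only: o_apply cinv_ctb_chart[OF A(1,2,4)] cmap_ctb_chart)
qed

section \<open>Cotangent transition maps are symplectic\<close>

lemma transition_Ck_on:
  "manifold A \<Longrightarrow> c \<in> A \<Longrightarrow> d \<in> A \<Longrightarrow> Ck_on k (cmap c ` (cdom c \<inter> cdom d)) (cmap d \<circ> cinv c)"
  unfolding manifold_def smooth_on_def by blast

text \<open>The difficulty is the fibre component, a functional-valued map. Differentiability is at
  hand for \<open>\<psi>' z w\<close> with \<open>w\<close> fixed; expansion in the dual basis turns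
  the component into a finite sum to which the product rule applies. The second-derivative term
  comes from moving the base point of \<open>\<psi>'\<close>.\<close>

lemma ctb_transition_has_derivative:
  fixes A :: "('a, 'e::real_normed_vector) atlas" and a :: "'e \<Rightarrow>\<^sub>L real"
  assumes A: "manifold A" "c \<in> A" "d \<in> A" "q \<in> cdom c" "q \<in> cdom d"
  defines "\<phi>' \<equiv> frechet_derivative (cmap d \<circ> cinv c) (at (cmap c q))"
    and "\<psi>' \<equiv> \<lambda>z. frechet_derivative (cmap c \<circ> cinv d) (at z)"
  obtains T where
    "((cmap (ctb_chart A d) \<circ> cinv (ctb_chart A c)) has_derivative T) (at (cmap c q, a))"
    "\<And>h. fst (T h) = \<phi>' (fst h)"
    "\<And>h w. blinfun_apply (snd (T h)) w = blinfun_apply (snd h) (\<psi>' (cmap d q) w)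
       + blinfun_apply a (frechet_derivative (\<lambda>z. \<psi>' z w) (at (cmap d q)) (\<phi>' (fst h)))"
proof -
  note dA = manifold_imp_diff_atlas[OF A(1)]
  define \<phi> where "\<phi> = cmap d \<circ> cinv c"
  define x where "x = cmap c q"
  define W where "W = cmap c ` (cdom c \<inter> cdom d)"
  define W' where "W' = cmap d ` (cdom d \<inter> cdom c)"
  have \<phi>x: "\<phi> x = cmap d q"
    using A cinv_cmap[OF dA] by (simp add: \<phi>_def x_def)
  have W: "open W" "x \<in> W" and W': "open W'" "\<phi> x \<in> W'"
    using A open_overlap[OF dA A(2,3)] open_overlap[OF dA A(3,2)]
    unfolding W_def W'_def \<phi>x unfolding x_def by blast+
  obtain B :: "'e set" where B: "finite B" "span B = UNIV"
    using A(1) unfolding manifold_def by blast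
  obtain C and e :: "'e \<Rightarrow> 'e \<Rightarrow>\<^sub>L real" where fin: "finite C"
    and e: "\<And>x. x = (\<Sum>b\<in>C. blinfun_apply (e b) x *\<^sub>R b)"
    using finite_span_coordinates[OF B] by blast
  have \<phi>': "(\<phi> has_derivative \<phi>') (at x)"
    using transition_has_derivative[OF dA A(2-5)] unfolding \<phi>_def \<phi>'_def x_def .
  have \<psi>': "bounded_linear (\<psi>' z)" if "z \<in> W'" for z
  proof -
    obtain p where "p \<in> cdom d" "p \<in> cdom c" "z = cmap d p"
      using \<open>z \<in> W'\<close> unfolding W'_def by blast
    then show ?thesis
      using transition_has_derivative[OF dA A(3,2)] has_derivative_bounded_linear
      unfolding \<psi>'_def by blast
  qed
  have expand: "\<psi>' z w = (\<Sum>b\<in>C. blinfun_apply (e b) w *\<^sub>R \<psi>' z b)" if "z \<in> W'" for z w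
  proof -
    have lin: "linear (\<psi>' z)"
      using \<psi>'[OF that] bounded_linear.linear by blast
    have "\<psi>' z w = \<psi>' z (\<Sum>b\<in>C. blinfun_apply (e b) w *\<^sub>R b)"
      using e[of w] by simp
    then show ?thesis
      by (simp add: linear_sum[OF lin] linear_scale[OF lin])
  qed
  define N where "N = (\<lambda>w. frechet_derivative (\<lambda>z. \<psi>' z w) (at (\<phi> x)))"
  have N: "((\<lambda>z. \<psi>' z w) has_derivative N w) (at (\<phi> x))" for w
  proof -
    have "(\<lambda>z. \<psi>' z w) differentiable (at (\<phi> x))"
      using transition_Ck_on[OF A(1,3,2), of "Suc (Suc 0)"] W'(2) unfolding \<psi>'_def W'_def by auto
    then show ?thesis
      using frechet_derivative_works unfolding N_def by blast
  qed
  \<comment> \<open>\<open>N w\<close> is defined separately for each \<open>w\<close>; its linear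
    dependence on \<open>w\<close> is recovered by differentiating \<open>expand\<close>.\<close>
  have N_expand: "N w v = (\<Sum>b\<in>C. blinfun_apply (e b) w *\<^sub>R N b v)" for w v
  proof -
    have "((\<lambda>z. \<Sum>b\<in>C. blinfun_apply (e b) w *\<^sub>R \<psi>' z b) has_derivative
        (\<lambda>v. \<Sum>b\<in>C. blinfun_apply (e b) w *\<^sub>R N b v)) (at (\<phi> x))"
      by (intro has_derivative_sum has_derivative_scaleR_right N)
    then have "((\<lambda>z. \<psi>' z w) has_derivative
        (\<lambda>v. \<Sum>b\<in>C. blinfun_apply (e b) w *\<^sub>R N b v)) (at (\<phi> x))"
      by (rule has_derivative_transform_within_open[OF _ W']) (rule expand[symmetric])
    from fun_cong[OF has_derivative_unique[OF N this]] show ?thesis .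
  qed
  define T where "T = (\<lambda>h. (\<phi>' (fst h),
    \<Sum>b\<in>C. (blinfun_apply a (N b (\<phi>' (fst h))) + blinfun_apply (snd h) (\<psi>' (\<phi> x) b)) *\<^sub>R e b))"
  have "((\<lambda>p. (\<phi> (fst p), \<Sum>b\<in>C. blinfun_apply (snd p) (\<psi>' (\<phi> (fst p)) b) *\<^sub>R e b))
      has_derivative T) (at (x, a))"
    unfolding T_def
  proof (intro has_derivative_Pair has_derivative_sum has_derivative_scaleR_left)
    have fst: "(fst has_derivative fst) (at (x, a))" and snd: "(snd has_derivative snd) (at (x, a))"
      by (auto intro!: derivative_eq_intros)
    show 1: "((\<lambda>p. \<phi> (fst p)) has_derivative (\<lambda>h. \<phi>' (fst h))) (at (x, a))"
      using has_derivative_compose[OF fst] \<phi>' by simp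
    show "((\<lambda>p. blinfun_apply (snd p) (\<psi>' (\<phi> (fst p)) b)) has_derivative
        (\<lambda>h. blinfun_apply a (N b (\<phi>' (fst h))) + blinfun_apply (snd h) (\<psi>' (\<phi> x) b))) (at (x, a))" for b
      using bounded_bilinear.FDERIV[OF bounded_bilinear_blinfun_apply snd
          has_derivative_compose[OF 1, of "\<lambda>z. \<psi>' z b" "N b"]] N by simp
  qed
  then have "((cmap (ctb_chart A d) \<circ> cinv (ctb_chart A c)) has_derivative T) (at (x, a))"
  proof (rule has_derivative_transform_within_open)
    show "open (W \<times> (UNIV :: ('e \<Rightarrow>\<^sub>L real) set))" "(x, a) \<in> W \<times> UNIV"
      using W by (auto intro: open_Times)
    fix p :: "'e \<times> ('e \<Rightarrow>\<^sub>L real)" assume "p \<in> W \<times> UNIV"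
    then obtain r where r: "r \<in> cdom c" "r \<in> cdom d" "p = (cmap c r, snd p)"
      unfolding W_def by (cases p) auto
    have \<phi>r: "\<phi> (fst p) = cmap d r"
      unfolding arg_cong[OF r(3), of fst, unfolded fst_conv]
      using r A cinv_cmap[OF dA] by (simp add: \<phi>_def)
    have mem: "cmap d r \<in> W'"
      using r by (auto simp: W'_def)
    have bl: "bounded_linear (\<lambda>w. blinfun_apply (snd p) (\<psi>' (cmap d r) w))"
      using bounded_linear_compose[OF blinfun.bounded_linear_right \<psi>'[OF mem]] .
    have "Blinfun (\<lambda>w. blinfun_apply (snd p) (\<psi>' (cmap d r) w))
        = (\<Sum>b\<in>C. blinfun_apply (snd p) (\<psi>' (cmap d r) b) *\<^sub>R e b)"
    proof (rule blinfun_eqI)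
      fix w
      show "blinfun_apply (Blinfun (\<lambda>w. blinfun_apply (snd p) (\<psi>' (cmap d r) w))) w
          = blinfun_apply (\<Sum>b\<in>C. blinfun_apply (snd p) (\<psi>' (cmap d r) b) *\<^sub>R e b) w"
        by (subst bounded_linear_Blinfun_apply[OF bl], subst expand[OF mem])
          (simp add: blinfun.sum_right blinfun.sum_left blinfun.scaleR_left blinfun.scaleR_right mult.commute)
    qed
    moreover have "(cmap (ctb_chart A d) \<circ> cinv (ctb_chart A c)) p
        = (cmap d r, Blinfun (\<lambda>w. blinfun_apply (snd p) (\<psi>' (cmap d r) w)))"
      using ctb_transition[OF A(1-3) r(1,2), of "snd p"] unfolding r(3)[symmetric] \<psi>'_def .
    ultimately show "(\<phi> (fst p), \<Sum>b\<in>C. blinfun_apply (snd p) (\<psi>' (\<phi> (fst p)) b) *\<^sub>R e b)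
        = (cmap (ctb_chart A d) \<circ> cinv (ctb_chart A c)) p"
      unfolding \<phi>r by simp
  qed
  \<comment> \<open>Reading both expansions backwards removes the basis from the formula.\<close>
  moreover have "blinfun_apply (snd (T h)) w = blinfun_apply (snd h) (\<psi>' (\<phi> x) w)
       + blinfun_apply a (N w (\<phi>' (fst h)))" for h w
    by (subst expand[OF W'(2)], subst N_expand[of w])
      (simp add: T_def blinfun.sum_right blinfun.sum_left blinfun.scaleR_left blinfun.scaleR_right
        distrib_left sum.distrib mult.commute)
  ultimately show ?thesis
    using that[of T] unfolding N_def \<phi>x unfolding x_def T_def fst_conv by blast
qed

lemma diff_atlas_ctb:
  assumes "manifold A"
  shows "diff_atlas (ctb A)"
  unfolding diff_atlas_def ctb_eq ball_simps
proof (intro conjI ballI)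
  fix c d m assume cd: "c \<in> A" "d \<in> A"
  show "open (cmap (ctb_chart A c) ` (cdom (ctb_chart A c) \<inter> cdom (ctb_chart A d)))"
    unfolding ctb_chart_overlap[OF assms cd(1)]
    using open_overlap[OF manifold_imp_diff_atlas[OF assms] cd] by (intro open_Times) auto
  assume m: "m \<in> cdom (ctb_chart A c) \<inter> cdom (ctb_chart A d)"
  then have q: "fst m \<in> cdom c" "fst m \<in> cdom d"
    by (auto simp: mem_cdom_ctb_chart)
  show "(cmap (ctb_chart A d) \<circ> cinv (ctb_chart A c)) differentiable (at (cmap (ctb_chart A c) m))"
    using ctb_transition_has_derivative[OF assms cd q, of "snd (cmap (ctb_chart A c) m)"]
    unfolding differentiable_def by (metis fst_cmap_ctb_chart prod.collapse)
qed (rule inj_on_ctb_chart[OF assms])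

text \<open>In the pairings the derivatives of the two opposite transitions compose to the identity.
  What remains is a second-derivative term paired with \<open>a\<close>; being symmetric in the two
  tangent vectors, it drops out of the difference.\<close>

lemma symplectic_pairing_chart_independent:
  fixes A :: "('a, 'e::real_normed_vector) atlas"
  assumes A: "manifold A" "c \<in> A" "d \<in> A"
    and m: "m \<in> cdom (ctb_chart A c)" "m \<in> cdom (ctb_chart A d)"
    and U: "U \<in> tspace (ctb A) m" and V: "V \<in> tspace (ctb A) m"
  shows "blinfun_apply (snd (U (ctb_chart A d))) (fst (V (ctb_chart A d)))
        - blinfun_apply (snd (V (ctb_chart A d))) (fst (U (ctb_chart A d)))
       = blinfun_apply (snd (U (ctb_chart A c))) (fst (V (ctb_chart A c)))
        - blinfun_apply (snd (V (ctb_chart A c))) (fst (U (ctb_chart A c)))"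
proof -
  note dA = manifold_imp_diff_atlas[OF A(1)]
  define q where "q = fst m"
  define a where "a = snd (cmap (ctb_chart A c) m)"
  have q: "q \<in> cdom c" "q \<in> cdom d"
    using m by (auto simp: q_def mem_cdom_ctb_chart)
  have xa: "cmap (ctb_chart A c) m = (cmap c q, a)"
    by (simp add: a_def q_def prod_eq_iff fst_cmap_ctb_chart)
  define \<phi>' where "\<phi>' = frechet_derivative (cmap d \<circ> cinv c) (at (cmap c q))"
  define \<psi>' where "\<psi>' = (\<lambda>z. frechet_derivative (cmap c \<circ> cinv d) (at z))"
  obtain T where T: "((cmap (ctb_chart A d) \<circ> cinv (ctb_chart A c)) has_derivative T) (at (cmap c q, a))"
    and fstT: "\<And>h. fst (T h) = \<phi>' (fst h)"
    and sndT: "\<And>h w. blinfun_apply (snd (T h)) w = blinfun_apply (snd h) (\<psi>' (cmap d q) w)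
       + blinfun_apply a (frechet_derivative (\<lambda>z. \<psi>' z w) (at (cmap d q)) (\<phi>' (fst h)))"
    using ctb_transition_has_derivative[OF A q, of a] unfolding \<phi>'_def \<psi>'_def by blast
  have TU: "X (ctb_chart A d) = T (X (ctb_chart A c))" if "X \<in> tspace (ctb A) m" for X
  proof -
    have "X (ctb_chart A d) = frechet_derivative (cmap (ctb_chart A d) \<circ> cinv (ctb_chart A c))
        (at (cmap (ctb_chart A c) m)) (X (ctb_chart A c))"
      using that A(2,3) m unfolding tspace_def ctb_eq by blast
    then show ?thesis
      using frechet_derivative_at[OF T] xa by simp
  qed
  have inv: "\<psi>' (cmap d q) (\<phi>' w) = w" for w
    unfolding \<psi>'_def \<phi>'_def
    using transition_derivative_comp[OF dA A(2,3,2) q q(1)] transition_derivative_self[OF dA A(2) q(1)]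
    by simp
  have sym: "blinfun_apply a (frechet_derivative (\<lambda>z. \<psi>' z u) (at (cmap d q)) v)
      = blinfun_apply a (frechet_derivative (\<lambda>z. \<psi>' z v) (at (cmap d q)) u)" for u v
    unfolding \<psi>'_def
    by (rule Ck_on_2_symmetric_blinfun[OF open_overlap[OF dA A(3,2)] _ transition_Ck_on[OF A(1,3,2)]])
      (use q in blast)
  show ?thesis
    unfolding TU[OF U] TU[OF V] fstT sndT inv
    using sym[of "\<phi>' (fst (U (ctb_chart A c)))" "\<phi>' (fst (V (ctb_chart A c)))"] by simp
qed

section \<open>The canonical forms in cotangent charts\<close>

lemma mem_pts_ctb:
  assumes "m \<in> pts (ctb A)"
  obtains c where "c \<in> A" "chart_at (ctb A) m = ctb_chart A c" "m \<in> cdom (ctb_chart A c)"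
proof -
  obtain c where c: "c \<in> A" "chart_at (ctb A) m = ctb_chart A c"
    using chart_at_in(1)[OF assms] unfolding ctb_eq by (rule imageE)
  show ?thesis
    by (rule that[OF c]) (use chart_at_in(2)[OF assms] in \<open>simp only: c(2)\<close>)
qed

text \<open>Serves to pass from the chart picked by \<open>chart_at\<close> to a prescribed one: the
  base component of the derivative of a cotangent transition ignores fibre directions.\<close>

lemma ctb_tangent_fst:
  assumes A: "manifold A" "c \<in> A" "d \<in> A"
    and m: "m \<in> cdom (ctb_chart A c)" "m \<in> cdom (ctb_chart A d)"
    and U: "U \<in> tspace (ctb A) m"
  shows "fst (U (ctb_chart A d))
    = frechet_derivative (cmap d \<circ> cinv c) (at (cmap c (fst m))) (fst (U (ctb_chart A c)))"
proof -
  have q: "fst m \<in> cdom c" "fst m \<in> cdom d"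
    using m by (auto simp: mem_cdom_ctb_chart)
  define a where "a = snd (cmap (ctb_chart A c) m)"
  have xa: "cmap (ctb_chart A c) m = (cmap c (fst m), a)"
    by (simp add: a_def prod_eq_iff fst_cmap_ctb_chart)
  obtain T where T: "((cmap (ctb_chart A d) \<circ> cinv (ctb_chart A c)) has_derivative T)
      (at (cmap c (fst m), a))"
    and fstT: "\<And>h. fst (T h) = frechet_derivative (cmap d \<circ> cinv c) (at (cmap c (fst m))) (fst h)"
    by (rule ctb_transition_has_derivative[OF A q, of a]) (assumption | rule that)+
  have "U (ctb_chart A d) = frechet_derivative (cmap (ctb_chart A d) \<circ> cinv (ctb_chart A c))
      (at (cmap (ctb_chart A c) m)) (U (ctb_chart A c))"
    using U A(2,3) m unfolding tspace_def ctb_eq by blast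
  also have "\<dots> = T (U (ctb_chart A c))"
    unfolding xa frechet_derivative_at[OF T] ..
  finally show ?thesis
    by (simp only: fstT)
qed

text \<open>In cotangent coordinates the footpoint map is the first projection of a product, so the
  chain rule with a linear inner map applies.\<close>

lemma base_map_has_derivative:
  assumes A: "manifold A" "c \<in> A" and m: "m \<in> cdom (ctb_chart A c)"
    and F: "((F \<circ> cinv c) has_derivative F') (at (cmap c (fst m)))"
  shows "((F \<circ> fst \<circ> cinv (ctb_chart A c)) has_derivative (\<lambda>h. F' (fst h)))
           (at (cmap (ctb_chart A c) m))"
proof (rule has_derivative_transform_within_open)
  have "(fst has_derivative fst) (at (cmap (ctb_chart A c) m))"
    by (auto intro!: derivative_eq_intros)
  then show "((\<lambda>p. (F \<circ> cinv c) (fst p)) has_derivative (\<lambda>h. F' (fst h)))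
      (at (cmap (ctb_chart A c) m))"
    using has_derivative_compose[of fst fst "cmap (ctb_chart A c) m" UNIV "F \<circ> cinv c" F'] F
    by (simp add: fst_cmap_ctb_chart)
  have "ctb_chart A c \<in> ctb A"
    using A by (simp add: ctb_eq)
  then show "open (cimg (ctb_chart A c))"
    using open_cimg diff_atlas_ctb[OF A(1)] by blast
  show "cmap (ctb_chart A c) m \<in> cimg (ctb_chart A c)"
    using m by blast
  fix p assume "p \<in> cimg (ctb_chart A c)"
  then obtain q b where q: "q \<in> cdom c" "p = (cmap c q, b)"
    unfolding cimg_ctb_chart[OF A] by (cases p) auto
  show "(F \<circ> cinv c) (fst p) = (F \<circ> fst \<circ> cinv (ctb_chart A c)) p"
    unfolding q(2) by (simp add: cinv_ctb_chart[OF A q(1)] cinv_cmap[OF manifold_imp_diff_atlas[OF A(1)] A(2) q(1)])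
qed

text \<open>\<open>tmap\<close> works in the chart \<open>c0\<close> from \<open>chart_at\<close>;
  the cocycle rule for \<open>c0\<close>, \<open>c\<close> and \<open>d\<close> carries the result
  to the prescribed \<open>c\<close>.\<close>

lemma tmap_ctb_fst:
  assumes A: "manifold A" "c \<in> A" and m: "m \<in> cdom (ctb_chart A c)"
    and U: "U \<in> tspace (ctb A) m"
  shows "tmap (ctb A) A fst m U = tvec_of A c (fst m) (fst (U (ctb_chart A c)))"
proof
  fix d
  note dA = manifold_imp_diff_atlas[OF A(1)]
  have "m \<in> pts (ctb A)"
    using m A(2) unfolding pts_def ctb_eq by blast
  then obtain c0 where c0: "c0 \<in> A" "chart_at (ctb A) m = ctb_chart A c0" "m \<in> cdom (ctb_chart A c0)"
    by (rule mem_pts_ctb)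
  have q: "fst m \<in> cdom c" "fst m \<in> cdom c0"
    using m c0(3) by (auto simp: mem_cdom_ctb_chart)
  show "tmap (ctb A) A fst m U d = tvec_of A c (fst m) (fst (U (ctb_chart A c))) d"
  proof (cases "d \<in> A \<and> fst m \<in> cdom d")
    case True
    then have d: "d \<in> A" "fst m \<in> cdom d"
      by auto
    have "frechet_derivative (cmap d \<circ> fst \<circ> cinv (ctb_chart A c0)) (at (cmap (ctb_chart A c0) m))
        = (\<lambda>h. frechet_derivative (cmap d \<circ> cinv c0) (at (cmap c0 (fst m))) (fst h))"
      using frechet_derivative_at[OF base_map_has_derivative[OF A(1) c0(1,3)
            transition_has_derivative[OF dA c0(1) d(1) q(2) d(2)]]] by (rule sym)
    moreover have "frechet_derivative (cmap d \<circ> cinv c) (at (cmap c (fst m))) (fst (U (ctb_chart A c)))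
       = frechet_derivative (cmap d \<circ> cinv c0) (at (cmap c0 (fst m))) (fst (U (ctb_chart A c0)))"
      unfolding ctb_tangent_fst[OF A(1) c0(1) A(2) c0(3) m U]
      by (rule transition_derivative_comp[OF dA c0(1) A(2) d(1) q(2,1) d(2)])
    ultimately show ?thesis
      using True by (simp add: tmap_def Let_def c0(2) tvec_of_def)
  next
    case False
    then show ?thesis
      unfolding tmap_def tvec_of_def Let_def by presburger
  qed
qed

text \<open>This is \<open>p dq\<close>, in any cotangent chart around \<open>m\<close>.\<close>

lemma canonical_1form_chart:
  assumes A: "manifold A" "c \<in> A" and m: "m \<in> cdom (ctb_chart A c)"
    and U: "U \<in> tspace (ctb A) m"
  shows "canonical_1form A m U
    = blinfun_apply (snd (cmap (ctb_chart A c) m)) (fst (U (ctb_chart A c)))"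
  unfolding canonical_1form_def tmap_ctb_fst[OF assms] snd_cmap_ctb_chart[OF A m] ..

text \<open>Differentiability is given in \<open>c\<close> while \<open>d0\<close> evaluates in
  \<open>c0\<close>; the function and the base part of \<open>U\<close> are both expressed through
  the transition from \<open>c0\<close> to \<open>c\<close>.\<close>

lemma d0_base_function:
  assumes A: "manifold A" "c \<in> A" and m: "m \<in> cdom (ctb_chart A c)"
    and U: "U \<in> tspace (ctb A) m" and f: "(f \<circ> cinv c) differentiable (at (cmap c (fst m)))"
  shows "d0 (ctb A) (f \<circ> fst) m U
    = frechet_derivative (f \<circ> cinv c) (at (cmap c (fst m))) (fst (U (ctb_chart A c)))"
proof -
  note dA = manifold_imp_diff_atlas[OF A(1)]
  have "m \<in> pts (ctb A)"
    using m A(2) unfolding pts_def ctb_eq by blast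
  then obtain c0 where c0: "c0 \<in> A" "chart_at (ctb A) m = ctb_chart A c0" "m \<in> cdom (ctb_chart A c0)"
    by (rule mem_pts_ctb)
  have q: "fst m \<in> cdom c" "fst m \<in> cdom c0"
    using m c0(3) by (auto simp: mem_cdom_ctb_chart)
  have F: "((f \<circ> cinv c) has_derivative frechet_derivative (f \<circ> cinv c) (at (cmap c (fst m))))
      (at (cmap c (fst m)))"
    using f frechet_derivative_works by blast
  from frechet_derivative_at[OF base_map_has_derivative[OF A(1) c0(1,3)
        has_derivative_change_chart[OF dA c0(1) A(2) q(2,1) F]]]
  show ?thesis
    unfolding d0_def c0(2) Let_def ctb_tangent_fst[OF A(1) c0(1) A(2) c0(3) m U]
    by (rule fun_cong[OF sym])
qed

text \<open>\<open>d1\<close> differentiates this coefficient, hence the formula covers the whole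
  chart image.\<close>

lemma loc1_canonical_1form:
  assumes A: "manifold A" "c \<in> A" and y: "y \<in> cimg (ctb_chart A c)"
  shows "loc1 (ctb A) (ctb_chart A c) (canonical_1form A) y u = blinfun_apply (snd y) (fst u)"
proof -
  have c: "ctb_chart A c \<in> ctb A"
    using A by (simp add: ctb_eq)
  note dT = diff_atlas_ctb[OF A(1)]
  define n where "n = cinv (ctb_chart A c) y"
  have n: "n \<in> cdom (ctb_chart A c)" "cmap (ctb_chart A c) n = y"
    using y by (auto simp: n_def inv_into_into f_inv_into_f)
  show ?thesis
    unfolding loc1_def Let_def n_def[symmetric] canonical_1form_chart[OF A n(1) tvec_of_in_tspace[OF dT c n(1)]]
      tvec_of_apply_self[OF dT c n(1)] n(2) ..
qed

text \<open>The formula is \<open>dq ^ dp\<close>, the sign coming from minus the exterior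
  derivative of \<open>p dq\<close>. The coefficients of \<open>p dq\<close> are linear in the
  point, so \<open>d1\<close> is read off in the chart from \<open>chart_at\<close>; chart
  independence of the pairing transfers the result to \<open>c\<close>.\<close>

lemma canonical_2form_chart:
  assumes A: "manifold A" "c \<in> A" and m: "m \<in> cdom (ctb_chart A c)"
    and U: "U \<in> tspace (ctb A) m" and V: "V \<in> tspace (ctb A) m"
  shows "canonical_2form A m U V
    = blinfun_apply (snd (V (ctb_chart A c))) (fst (U (ctb_chart A c)))
    - blinfun_apply (snd (U (ctb_chart A c))) (fst (V (ctb_chart A c)))"
proof -
  have "m \<in> pts (ctb A)"
    using m A(2) unfolding pts_def ctb_eq by blast
  then obtain c0 where c0: "c0 \<in> A" "chart_at (ctb A) m = ctb_chart A c0" "m \<in> cdom (ctb_chart A c0)"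
    by (rule mem_pts_ctb)
  have "ctb_chart A c0 \<in> ctb A"
    using c0 by (simp add: ctb_eq)
  then have op: "open (cimg (ctb_chart A c0))"
    using open_cimg diff_atlas_ctb[OF A(1)] by blast
  have der: "frechet_derivative (\<lambda>y. loc1 (ctb A) (ctb_chart A c0) (canonical_1form A) y w)
      (at (cmap (ctb_chart A c0) m)) h = blinfun_apply (snd h) (fst w)" for w h
  proof -
    have "((\<lambda>y. blinfun_apply (snd y) (fst w)) has_derivative (\<lambda>h. blinfun_apply (snd h) (fst w)))
        (at (cmap (ctb_chart A c0) m))"
      by (intro bounded_linear.has_derivative[OF blinfun.bounded_linear_left] has_derivative_snd
          has_derivative_ident)
    then have "((\<lambda>y. loc1 (ctb A) (ctb_chart A c0) (canonical_1form A) y w)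
        has_derivative (\<lambda>h. blinfun_apply (snd h) (fst w))) (at (cmap (ctb_chart A c0) m))"
      by (rule has_derivative_transform_within_open[OF _ op])
        (use c0(3) in \<open>auto simp: loc1_canonical_1form[OF A(1) c0(1)]\<close>)
    from fun_cong[OF frechet_derivative_at[OF this], of h] show ?thesis
      by (rule sym)
  qed
  show ?thesis
    using symplectic_pairing_chart_independent[OF A(1) c0(1) A(2) c0(3) m U V]
    unfolding canonical_2form_def d1_def c0(2) Let_def der by linarith
qed

section \<open>Closedness of the rescaled form\<close>

text \<open>The hypothesis fixes \<open>f * \<gamma>\<close> at every point, so the coefficients of
  the form involve just \<open>F\<close>, its first derivative and the cotangent coordinates.
  Closedness is then an expansion of \<open>d2\<close> in one chart.\<close>

lemma closed2_conformal_factor: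
  fixes A :: "('a, 'e::real_normed_vector) atlas"
  assumes A: "manifold A" and f: "smooth_fun A f"
    and \<gamma>: "form2_eq (ctb A)
      (\<lambda>m u v. wedge11 (d0 (ctb A) (f \<circ> fst)) (canonical_1form A) m u v - f (fst m) * \<gamma> m u v)
      (\<lambda>m u v. 0)"
  shows "closed2 (ctb A) (\<lambda>m u v. f (fst m) * (canonical_2form A m u v - \<gamma> m u v))"
  unfolding closed2_def
proof (intro ballI)
  fix m U V W assume m: "m \<in> pts (ctb A)"
  obtain c where c: "c \<in> A" "chart_at (ctb A) m = ctb_chart A c" "m \<in> cdom (ctb_chart A c)"
    using m by (rule mem_pts_ctb)
  note dA = manifold_imp_diff_atlas[OF A] and dT = diff_atlas_ctb[OF A]
  have cT: "ctb_chart A c \<in> ctb A"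
    using c by (simp add: ctb_eq)
  define F where "F = f \<circ> cinv c"
  define DF where "DF = (\<lambda>x. frechet_derivative F (at x))"
  define x where "x = cmap c (fst m)"
  define a where "a = snd (cmap (ctb_chart A c) m)"
  define D2 where "D2 = (\<lambda>w. frechet_derivative (\<lambda>z. DF z w) (at x))"
  have xa: "cmap (ctb_chart A c) m = (x, a)"
    by (simp add: a_def x_def prod_eq_iff fst_cmap_ctb_chart)
  have x: "x \<in> cimg c"
    using c(3) by (simp add: x_def mem_cdom_ctb_chart)
  have Ck: "Ck_on (Suc (Suc 0)) (cimg c) F"
    using f c(1) unfolding smooth_fun_def smooth_on_def F_def by blast
  have diffF: "F differentiable (at z)" if "z \<in> cimg c" for z
    using Ck that unfolding Ck_on.simps by blast
  have DF: "(F has_derivative DF x) (at x)"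
    using diffF[OF x] frechet_derivative_works unfolding DF_def by blast
  have "(\<lambda>z. DF z w) differentiable (at x)" for w
    using Ck x unfolding DF_def Ck_on.simps by blast
  then have D2: "((\<lambda>z. DF z w) has_derivative D2 w) (at x)" for w
    using frechet_derivative_works unfolding D2_def by blast
  have D2_sym: "D2 u v = D2 v u" for u v
    unfolding D2_def DF_def by (rule Ck_on_2_symmetric[OF open_cimg[OF dA c(1)] x Ck])
  define \<omega> where "\<omega> = (\<lambda>m u v. f (fst m) * (canonical_2form A m u v - \<gamma> m u v))"
  \<comment> \<open>The base chart \<open>c\<close> stays fixed over the whole chart image, although
    the chart used by \<open>d0\<close> and the canonical forms may change from point to
    point.\<close>
  have loc: "loc2 (ctb A) (ctb_chart A c) \<omega> y u v
      = F (fst y) * (blinfun_apply (snd v) (fst u) - blinfun_apply (snd u) (fst v))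
        - (DF (fst y) (fst u) * blinfun_apply (snd y) (fst v)
           - DF (fst y) (fst v) * blinfun_apply (snd y) (fst u))"
    if "y \<in> cimg (ctb_chart A c)" for y u v
  proof -
    define n where "n = cinv (ctb_chart A c) y"
    have n: "n \<in> cdom (ctb_chart A c)" "cmap (ctb_chart A c) n = y"
      using that by (auto simp: n_def inv_into_into f_inv_into_f)
    have q: "fst n \<in> cdom c" "fst y = cmap c (fst n)"
      using n(1) n(2)[symmetric] by (auto simp: mem_cdom_ctb_chart fst_cmap_ctb_chart)
    have Fn: "F (fst y) = f (fst n)"
      using cinv_cmap[OF dA c(1) q(1)] by (simp add: F_def q(2))
    define u' v' where "u' = tvec_of (ctb A) (ctb_chart A c) n u"
      and "v' = tvec_of (ctb A) (ctb_chart A c) n v"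
    have t: "u' \<in> tspace (ctb A) n" "v' \<in> tspace (ctb A) n"
      and s: "u' (ctb_chart A c) = u" "v' (ctb_chart A c) = v"
      using tvec_of_in_tspace[OF dT cT n(1)] tvec_of_apply_self[OF dT cT n(1)]
      by (simp_all add: u'_def v'_def)
    have "n \<in> pts (ctb A)"
      using n(1) cT unfolding pts_def by blast
    \<comment> \<open>The hypothesis is applied at the moving point \<open>n\<close>, which makes
      the resulting identity of coefficients differentiable.\<close>
    then have "f (fst n) * \<gamma> n u' v' = wedge11 (d0 (ctb A) (f \<circ> fst)) (canonical_1form A) n u' v'"
      using \<gamma> t unfolding form2_eq_def by auto
    also have "\<dots> = DF (fst y) (fst u) * blinfun_apply (snd y) (fst v)
           - DF (fst y) (fst v) * blinfun_apply (snd y) (fst u)"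
    proof -
      have "d0 (ctb A) (f \<circ> fst) n w = DF (fst y) (fst (w (ctb_chart A c)))"
        if "w \<in> tspace (ctb A) n" for w
        unfolding DF_def F_def q(2)
        by (rule d0_base_function[OF A c(1) n(1) that diffF[unfolded F_def, OF imageI[OF q(1)]]])
      then show ?thesis
        unfolding wedge11_def
        using canonical_1form_chart[OF A c(1) n(1)] t s n(2) by simp
    qed
    finally show ?thesis
      unfolding loc2_def Let_def n_def[symmetric] \<omega>_def u'_def[symmetric] v'_def[symmetric]
      using canonical_2form_chart[OF A c(1) n(1) t] s Fn by (simp add: right_diff_distrib)
  qed
  \<comment> \<open>In the first summand only \<open>F\<close> depends on the point; the second
    derivatives of \<open>F\<close> come from the wedge term alone.\<close>
  have der: "frechet_derivative (\<lambda>y. loc2 (ctb A) (ctb_chart A c) \<omega> y u v) (at (x, a)) h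
      = DF x (fst h) * (blinfun_apply (snd v) (fst u) - blinfun_apply (snd u) (fst v))
        - (DF x (fst u) * blinfun_apply (snd h) (fst v) + D2 (fst u) (fst h) * blinfun_apply a (fst v)
           - (DF x (fst v) * blinfun_apply (snd h) (fst u) + D2 (fst v) (fst h) * blinfun_apply a (fst u)))"
    for u v h
  proof -
    have fst: "(fst has_derivative fst) (at (x, a))" and snd: "(snd has_derivative snd) (at (x, a))"
      by (auto intro!: derivative_eq_intros)
    have 1: "((\<lambda>y. F (fst y)) has_derivative (\<lambda>h. DF x (fst h))) (at (x, a))"
      using has_derivative_compose[OF fst] DF by simp
    have 2: "((\<lambda>y. DF (fst y) w) has_derivative (\<lambda>h. D2 w (fst h))) (at (x, a))" for w
      using has_derivative_compose[OF fst, of "\<lambda>z. DF z w" "D2 w"] D2 by simp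
    have 3: "((\<lambda>y. blinfun_apply (snd y) w) has_derivative (\<lambda>h. blinfun_apply (snd h) w)) (at (x, a))"
      for w
      by (rule bounded_linear.has_derivative[OF blinfun.bounded_linear_left snd])
    have 4: "((\<lambda>y. DF (fst y) w * blinfun_apply (snd y) w') has_derivative
        (\<lambda>h. DF x w * blinfun_apply (snd h) w' + D2 w (fst h) * blinfun_apply a w')) (at (x, a))"
      for w w'
      using has_derivative_mult[OF 2 3] by simp
    have "((\<lambda>y. F (fst y) * (blinfun_apply (snd v) (fst u) - blinfun_apply (snd u) (fst v))
        - (DF (fst y) (fst u) * blinfun_apply (snd y) (fst v)
           - DF (fst y) (fst v) * blinfun_apply (snd y) (fst u))) has_derivative
      (\<lambda>h. DF x (fst h) * (blinfun_apply (snd v) (fst u) - blinfun_apply (snd u) (fst v))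
        - (DF x (fst u) * blinfun_apply (snd h) (fst v) + D2 (fst u) (fst h) * blinfun_apply a (fst v)
           - (DF x (fst v) * blinfun_apply (snd h) (fst u) + D2 (fst v) (fst h) * blinfun_apply a (fst u)))))
      (at (x, a))"
      by (intro has_derivative_diff has_derivative_mult_left 1 4)
    then have "((\<lambda>y. loc2 (ctb A) (ctb_chart A c) \<omega> y u v) has_derivative
      (\<lambda>h. DF x (fst h) * (blinfun_apply (snd v) (fst u) - blinfun_apply (snd u) (fst v))
        - (DF x (fst u) * blinfun_apply (snd h) (fst v) + D2 (fst u) (fst h) * blinfun_apply a (fst v)
           - (DF x (fst v) * blinfun_apply (snd h) (fst u) + D2 (fst v) (fst h) * blinfun_apply a (fst u)))))
      (at (x, a))"
    proof (rule has_derivative_transform_within_open[OF _ open_cimg[OF dT cT]])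
      show "(x, a) \<in> cimg (ctb_chart A c)"
        using c(3) xa by (metis imageI)
    qed (rule loc[symmetric])
    from fun_cong[OF frechet_derivative_at[OF this], of h] show ?thesis
      by (rule sym)
  qed
  \<comment> \<open>In the alternating sum the terms with first derivatives of \<open>F\<close>
    cancel by themselves, and those with second derivatives cancel in pairs by symmetry.\<close>
  have "d2 (ctb A) \<omega> m U V W = 0"
    unfolding d2_def c(2) Let_def xa der
    using D2_sym[of "fst (U (ctb_chart A c))" "fst (V (ctb_chart A c))"]
      D2_sym[of "fst (U (ctb_chart A c))" "fst (W (ctb_chart A c))"]
      D2_sym[of "fst (V (ctb_chart A c))" "fst (W (ctb_chart A c))"]
    by (simp add: algebra_simps)
  then show "d2 (ctb A) (\<lambda>m u v. f (fst m) * (canonical_2form A m u v - \<gamma> m u v)) m U V W = 0"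
    unfolding \<omega>_def .
qed

theorem proposition6p1:
  fixes Q :: "('q, 'eq::real_normed_vector) atlas"
    and \<kappa> :: "('q, 'eq) form2" and U :: "'q \<Rightarrow> real"
    and D W :: "('q, 'eq) distr"
    and G :: "'g monoid" and AG :: "('g, 'eg::real_normed_vector) atlas"
    and \<Phi> :: "'g \<Rightarrow> 'q \<Rightarrow> 'q"
    and gW :: "('g, 'eg) tvec set"
    and N :: "'g set" and AN :: "('g, 'en::real_normed_vector) atlas"
    and M :: "('q \<times> ('q, 'eq) covec, 'em::real_normed_vector) atlas"
    and Qb :: "('q set, 'eqb::real_normed_vector) atlas"
    and AH :: "('g set, 'eh::real_normed_vector) atlas"
    and JKb Bb :: "('q set \<times> ('q set, 'eqb) covec, 'eqb \<times> ('eqb \<Rightarrow>\<^sub>L real)) form2"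
    and Hb :: "'q set \<times> ('q set, 'eqb) covec \<Rightarrow> real"
    and Xnh :: "('q set \<times> ('q set, 'eqb) covec, 'eqb \<times> ('eqb \<Rightarrow>\<^sub>L real)) vfield"
    and \<kappa>b :: "('q set, 'eqb) form2"
    and S :: "('q set set, 'es::real_normed_vector) atlas"
    and R :: "(('q set \<times> ('q set, 'eqb) covec) set, 'er::real_normed_vector) atlas"
    and BB :: "(('q set \<times> ('q set, 'eqb) covec) set, 'er) form2"
    and \<mu> :: "('g set, 'eh) covec"
    and P :: "(('q set \<times> ('q set, 'eqb) covec) set, 'ep::real_normed_vector) atlas"
    and \<beta> :: "('q set set, 'es) form2"
    and f :: "'q set set \<Rightarrow> real"
  defines "H \<equiv> G Mod N"
  defines "\<pi> \<equiv> orbit (G\<lparr>carrier := N\<rparr>) \<Phi>"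
  defines "\<Psi> \<equiv> quotient_action \<Phi>"
  defines "\<rho>W \<equiv> rho_W Q Qb \<pi> D"
  defines "\<rho>H \<equiv> orbit H (cot_lift H Qb \<Psi>)"
  defines "\<tau>b \<equiv> orbit H \<Psi>"
  defines "Jb \<equiv> momentum_map H AH Qb \<Psi>"
  defines "Ab \<equiv> mechanical_connection H AH Qb \<Psi> \<kappa>b"
    \<comment> \<open>nonholonomic system\<close>
  assumes "manifold Q" and "riemannian_metric Q \<kappa>" and "smooth_fun Q U"
    and "distribution Q D" and "\<not> integrable_distr Q D"
    and "embedded_submanifold M (ctb Q)" and "pts M = constraint_set Q \<kappa> D"
    \<comment> \<open>symmetry group\<close>
    and "lie_group G AG" and "free_proper_action G AG Q \<Phi>"
    and "invariant_lagrangian G Q \<Phi> (lagrangian \<kappa> U)" and "invariant_distr G Q \<Phi> D"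
    and "\<forall>q\<in>pts Q. tspace Q q = {u + v | u v. u \<in> D q \<and> v \<in> vertical G AG Q \<Phi> q}"
    \<comment> \<open>vertical complement and vertical-symmetry condition\<close>
    and "distribution Q W" and "\<forall>q\<in>pts Q. W q \<subseteq> vertical G AG Q \<Phi> q"
    and "invariant_distr G Q \<Phi> W"
    and "\<forall>q\<in>pts Q. tspace Q q = {u + w | u w. u \<in> D q \<and> w \<in> W q} \<and> D q \<inter> W q = {0}"
    and "lie_subalgebra G AG gW" and "lie_ideal G AG gW"
    and "\<forall>q\<in>pts Q. W q = (\<lambda>\<eta>. inf_generator G AG Q \<Phi> \<eta> q) ` gW"
    and "N \<lhd> G" and "connected_subgroup_integrating G AG gW N AN"
    and "free_proper_action (G\<lparr>carrier := N\<rparr>) AN Q \<Phi>"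
    \<comment> \<open>compression to the cotangent bundle of \<open>Qb = Q/N\<close>\<close>
    and "orbit_manifold (G\<lparr>carrier := N\<rparr>) \<Phi> Q Qb"
    and "two_form (ctb Qb) JKb"
    and "form2_eq M (pull2 M (ctb Qb) \<rho>W JKb) (JK_form G AG Q \<Phi> D W M)"
    and "smooth_fun (ctb Qb) Hb" and "\<forall>m\<in>pts M. Hb (\<rho>W m) = hamiltonian Q \<kappa> U m"
    and "smooth_vfield_on (ctb Qb) (pts (ctb Qb)) Xnh"
    and "\<forall>m\<in>pts (ctb Qb). \<forall>v\<in>tspace (ctb Qb) m.
           canonical_2form Qb m (Xnh m) v - JKb m (Xnh m) v = d0 (ctb Qb) Hb m v"
    and "riemannian_metric Qb \<kappa>b"
    and "\<forall>q\<in>pts Q. \<forall>u\<in>D q. \<forall>v\<in>D q.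
           \<kappa>b (\<pi> q) (tmap Q Qb \<pi> q u) (tmap Q Qb \<pi> q v) = \<kappa> q u v"
    \<comment> \<open>residual abelian symmetry group \<open>H = G/N\<close>\<close>
    and "lie_group H AH" and "submersion_onto AG AH (\<lambda>g. N #>\<^bsub>G\<^esub> g)" and "comm_group H"
    and "free_proper_action H AH Qb \<Psi>"
    and "orbit_manifold H \<Psi> Qb S"
    and "orbit_manifold H (cot_lift H Qb \<Psi>) (ctb Qb) R"
    \<comment> \<open>the form \<open>Bb\<close>, and the form \<open>BB\<close> to which \<open>JKb + Bb\<close> descends\<close>
    and "two_form (ctb Qb) Bb"
    and "\<forall>m\<in>pts (ctb Qb). \<forall>v\<in>tspace (ctb Qb) m. Bb m (Xnh m) v = 0"
    and "basic2 (ctb Qb) R \<rho>H (\<lambda>m u v. JKb m u v + Bb m u v)"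
    and "two_form R BB"
    and "form2_eq (ctb Qb) (pull2 (ctb Qb) R \<rho>H BB) (\<lambda>m u v. JKb m u v + Bb m u v)"
    \<comment> \<open>the reduced level set \<open>P\<close> at \<open>\<mu>\<close>\<close>
    and "\<mu> \<in> dual (lie_algebra H AH)"
    and "embedded_submanifold P R"
    and "pts P = \<rho>H ` {m \<in> pts (ctb Qb). Jb m = \<mu>}"
    and "two_form S \<beta>"
    and "form2_eq Qb (pull2 Qb S \<tau>b \<beta>)
           (\<lambda>q u v. \<mu> (vec_d1 Qb (lie_algebra H AH) Ab q u v))"
    and "smooth_fun S f"
  defines "\<beta>T \<equiv> pull2 (ctb S) S fst \<beta>"
    and "\<Upsilon>BB \<equiv> pull2 (ctb S) P (shift_map H Qb S \<Psi> Ab \<mu>) (pull2 P R (\<lambda>x. x) BB)"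
  assumes sufficient: "form2_eq (ctb S)
      (\<lambda>m u v. wedge11 (d0 (ctb S) (f \<circ> fst)) (canonical_1form S) m u v
                - f (fst m) * (\<beta>T m u v + \<Upsilon>BB m u v))
      (\<lambda>m u v. 0)"
  shows "closed2 (ctb S)
      (\<lambda>m u v. f (fst m) * (canonical_2form S m u v - \<beta>T m u v - \<Upsilon>BB m u v))"
proof -
  have "manifold S"
    using \<open>orbit_manifold H \<Psi> Qb S\<close> unfolding orbit_manifold_def by blast
  \<comment> \<open>The two subtracted forms are treated as the single form \<open>\<gamma>\<close>;
    it remains to regroup the subtractions.\<close>
  from closed2_conformal_factor[OF this \<open>smooth_fun S f\<close> sufficient] show ?thesis
    by (simp only: diff_diff_eq)
qed

end
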